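(* Let $n\geq 2$, let $T$ be a trace-preserving, positive linear map on the space $\mathcal{M}_n$ of complex $n\times n$ matrices having a unique stationary state, and let $\Lambda:=\sigma(T)\setminus\{1\}$ be the set of its non-unit eigenvalues. Then $$\frac{1}{\min_{\lambda_i\in\Lambda}|1-\lambda_i|}\leq\kappa_{qu}\leq\frac{2\sqrt{16e-4}\,n^2}{\min_{\lambda_i\in\Lambda}|1-\lambda_i|},$$ where $$\kappa_{qu}=\sup_{\substack{\sigma\in\mathcal{M}_n,\ \sigma=\sigma^\dagger,\\ \mathrm{tr}(\sigma)=0,\ \sigma\neq0}}\frac{\|Z(\sigma)\|_1}{\|\sigma\|_1},\qquad Z:=(\mathrm{id}-T+T^\infty)^{-1}.$$
   Context: A linear map $T$ on $\mathcal{M}_n$ is positive if it maps positive semidefinite matrices to positive semidefinite matrices, and trace-preserving if $\mathrm{tr}(T(X))=\mathrm{tr}(X)$ for all $X$. A stationary state of $T$ is a positive semidefinite matrix $\rho$ with $\mathrm{tr}(\rho)=1$ and $T(\rho)=\rho$. $T^\infty$ denotes the projection onto the stationary state of $T$ (the spectral projection of $T$ for the eigenvalue $1$, i.e. $T^\infty(X)=\mathrm{tr}(X)\rho$); the map $\mathrm{id}-T+T^\infty$ is invertible. $\sigma(T)$ is the spectrum of $T$ as a linear operator on the $n^2$-dimensional space $\mathcal{M}_n$; $\|\cdot\|_1$ is the Schatten $1$-norm (trace norm), $\dagger$ is the Hermitian adjoint, and $e$ is Euler's number. *)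

theory Defs
  imports "HOL-Analysis.Analysis"
begin

type_synonym 'n cmat = "complex ^ 'n ^ 'n"

text \<open>
  The library's \<open>*s\<close> on \<open>complex ^ 'n ^ 'n\<close> scales rows by row vectors and \<open>*\<^sub>R\<close> has only
  real scalars, so the complex vector space structure on matrices is introduced here.
\<close>

definition mscale :: "complex \<Rightarrow> 'n::finite cmat \<Rightarrow> 'n cmat" (infixr \<open>*\<^sub>M\<close> 75) where
  "c *\<^sub>M A = (\<chi> i j. c * A $ i $ j)"

lemma vector_space_mscale: "vector_space (mscale :: complex \<Rightarrow> 'n::finite cmat \<Rightarrow> _)"
  by unfold_locales (simp_all add: mscale_def vec_eq_iff algebra_simps)

definition dagger :: "'n::finite cmat \<Rightarrow> 'n cmat" where
  "dagger A = (\<chi> i j. cnj (A $ j $ i))"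

definition psd :: "'n::finite cmat \<Rightarrow> bool" where
  "psd A \<longleftrightarrow> dagger A = A \<and> (\<forall>x. 0 \<le> Re (\<Sum>i\<in>UNIV. cnj (x $ i) * (A *v x) $ i))"

definition psd_sqrt :: "'n::finite cmat \<Rightarrow> 'n cmat" where
  "psd_sqrt A = (THE P. psd P \<and> P ** P = A)"

definition trace_norm :: "'n::finite cmat \<Rightarrow> real" where
  "trace_norm A = Re (trace (psd_sqrt (dagger A ** A)))"

definition positive_map :: "('n::finite cmat \<Rightarrow> 'n cmat) \<Rightarrow> bool" where
  "positive_map T \<longleftrightarrow> (\<forall>X. psd X \<longrightarrow> psd (T X))"

definition trace_preserving :: "('n::finite cmat \<Rightarrow> 'n cmat) \<Rightarrow> bool" where
  "trace_preserving T \<longleftrightarrow> (\<forall>X. trace (T X) = trace X)"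

definition stationary_state :: "('n::finite cmat \<Rightarrow> 'n cmat) \<Rightarrow> 'n cmat \<Rightarrow> bool" where
  "stationary_state T \<rho> \<longleftrightarrow> psd \<rho> \<and> trace \<rho> = 1 \<and> T \<rho> = \<rho>"

text \<open>Only meaningful if \<open>T\<close> has exactly one stationary state.\<close>

definition T_inf :: "('n::finite cmat \<Rightarrow> 'n cmat) \<Rightarrow> 'n cmat \<Rightarrow> 'n cmat" where
  "T_inf T X = trace X *\<^sub>M (THE \<rho>. stationary_state T \<rho>)"

definition Z_map :: "('n::finite cmat \<Rightarrow> 'n cmat) \<Rightarrow> 'n cmat \<Rightarrow> 'n cmat" where
  "Z_map T = inv (\<lambda>X. X - T X + T_inf T X)"

definition op_spectrum :: "('n::finite cmat \<Rightarrow> 'n cmat) \<Rightarrow> complex set" where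
  "op_spectrum T = {l. \<not> bij (\<lambda>X. l *\<^sub>M X - T X)}"

lemma linear_mscale_imp_linear:
  fixes T :: "'n::finite cmat \<Rightarrow> 'n cmat"
  assumes "Vector_Spaces.linear mscale mscale T"
  shows "linear T"
proof -
  interpret Vector_Spaces.linear mscale mscale T by fact
  have scaleR: "r *\<^sub>R X = complex_of_real r *\<^sub>M X" for r and X :: "'n cmat"
    by (simp add: mscale_def vec_eq_iff scaleR_conv_of_real[where 'a = complex])
  then show ?thesis
    by (intro linearI) (simp_all only: add scale scaleR)
qed

lemma op_spectrum_eq_eigenvalues:
  fixes T :: "'n::finite cmat \<Rightarrow> 'n cmat"
  assumes "Vector_Spaces.linear mscale mscale T"
  shows "op_spectrum T = {l. \<exists>X. X \<noteq> 0 \<and> T X = l *\<^sub>M X}"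
proof -
  have T: "linear T"
    using assms by (rule linear_mscale_imp_linear)
  have "linear (\<lambda>X. l *\<^sub>M X - T X)" for l
    by (intro linear_compose_sub T linearI)
       (simp_all add: mscale_def vec_eq_iff algebra_simps)
  note lin = this
  have "bij (\<lambda>X. l *\<^sub>M X - T X) \<longleftrightarrow> inj (\<lambda>X. l *\<^sub>M X - T X)" for l
    using linear_injective_imp_surjective[OF lin[of l]] by (auto simp: bij_def)
  moreover have "inj (\<lambda>X. l *\<^sub>M X - T X) \<longleftrightarrow> (\<forall>X. T X = l *\<^sub>M X \<longrightarrow> X = 0)" for l
    unfolding linear_injective_0[OF lin] right_minus_eq by (metis (no_types))
  ultimately show ?thesis
    unfolding op_spectrum_def by blast
qed

definition kappa_qu :: "('n::finite cmat \<Rightarrow> 'n cmat) \<Rightarrow> real" where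
  "kappa_qu T = (SUP \<sigma> \<in> {\<sigma>. \<sigma> = dagger \<sigma> \<and> trace \<sigma> = 0 \<and> \<sigma> \<noteq> 0}.
                   trace_norm (Z_map T \<sigma>) / trace_norm \<sigma>)"

end

theory Submission
  imports Defs "HOL-Computational_Algebra.Fundamental_Theorem_Algebra"
begin

text \<open>
  Both bounds concern \<open>id - T\<close> on the traceless matrices. There \<open>T\<^sup>\<infinity>\<close> vanishes and, because the
  stationary state is unique, \<open>T\<close> has no nonzero fixed point (\<open>traceless_fixed_eq_0\<close>). So \<open>Z\<close>
  is the inverse of \<open>id - T\<close> there, and \<open>\<Lambda>\<close> is the set of eigenvalues of \<open>T\<close> with traceless
  eigenvectors.

  Lower bound (\<open>eigenvalue_lower_bound\<close>). \<open>Z\<close> multiplies an eigenvector \<open>X\<close> for \<open>l\<close> by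
  \<open>1 / (1 - l)\<close>. Up to the factor \<open>1 / \<bar>1 - l\<bar>\<close> it therefore permutes the Hermitian parts of the matrices
  \<open>c X\<close> with \<open>\<bar>c\<bar> = 1\<close>, and comparing suprema of trace norms gives \<open>1 / \<bar>1 - l\<bar> \<le> \<kappa>\<close>.

  Upper bound (\<open>trace_norm_Z_map_le\<close>). On Hermitian matrices \<open>T\<close> is a contraction for the trace
  norm. Hence if \<open>w = Z \<sigma>\<close> can be written as \<open>\<Sum>k. f\<^sub>k T^k \<sigma>\<close>, then
  \<open>\<parallel>w\<parallel>\<^sub>1 \<le> (\<Sum>k. \<bar>f\<^sub>k\<bar>) \<parallel>\<sigma>\<parallel>\<^sub>1\<close>. Such a representation exists for \<open>f(z) = (1 - g(z)) / (1 - z)\<close>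
  whenever \<open>g(1) = 1\<close> and \<open>g(T) w = 0\<close>. Let \<open>\<Prod>i. (z - l\<^sub>i)\<close> annihilate \<open>w\<close>, with at most
  \<open>2 n\<^sup>2\<close> zeros in \<open>\<Lambda>\<close> (\<open>annihilating_poly_exists\<close>, \<open>annihilating_roots\<close>), and let \<open>g\<close> be
  the Blaschke product with these zeros for a disc of radius \<open>1 / t > 1\<close>, divided by its value at
  \<open>1\<close>. After rescaling the disc to the unit disc, \<open>g = B / B(t)\<close>, and \<open>f\<close> becomes, up to a factor, the
  divided difference \<open>(B(y) - B(t)) / (y - t)\<close>. Multiplication by \<open>B\<close> preserves the
  \<open>\<ell>\<^sup>2\<close> norm of coefficients, so this divided difference has \<open>\<ell>\<^sup>2\<close> norm at most
  \<open>(1 - t\<^sup>2)^(- 1 / 2)\<close> (\<open>energy_diff_quot_le\<close>). The Cauchy-Schwarz inequality then yields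
  \<open>\<parallel>w\<parallel>\<^sub>1 \<le> t / ((1 - t\<^sup>2) \<bar>B(t)\<bar>) \<parallel>\<sigma>\<parallel>\<^sub>1\<close> (\<open>resolvent_trace_norm_le\<close>). If \<open>d\<close> is the distance from \<open>1\<close> to
  \<open>\<Lambda>\<close> and the radius is \<open>1 + d / (4 n\<^sup>2)\<close>, then \<open>\<bar>B(t)\<bar> \<ge> 1 / e\<close> (\<open>blaschke_lower_bound\<close>), and the
  bound becomes \<open>4 e n\<^sup>2 / d\<close>; finally \<open>4 e \<le> 2 sqrt (16 e - 4)\<close>.
\<close>

section \<open>Hermitian matrices and their spectral decomposition\<close>

definition cinner :: "complex ^ 'n::finite \<Rightarrow> complex ^ 'n \<Rightarrow> complex" where
  "cinner x y = (\<Sum>i\<in>UNIV. cnj (x $ i) * y $ i)"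

lemma cinner_simps:
  "cinner x (y + z) = cinner x y + cinner x z"
  "cinner x (y - z) = cinner x y - cinner x z"
  "cinner x (c *s y) = c * cinner x y"
  "cinner (c *s x) y = cnj c * cinner x y"
  "cinner x 0 = 0"
  by (simp_all add: cinner_def algebra_simps sum.distrib sum_subtractf sum_distrib_left)

lemma cnj_cinner: "cnj (cinner x y) = cinner y x"
  by (simp add: cinner_def mult.commute)

lemma inner_eq_Re_cinner: "x \<bullet> y = Re (cinner x y)"
  by (simp add: cinner_def inner_vec_def inner_complex_def)

lemma cinner_same: "cinner x x = complex_of_real ((norm x)\<^sup>2)"
proof -
  have "Im (cinner x x) = 0"
    using cnj_cinner[of x x] by (metis Reals_cnj_iff complex_is_Real_iff)
  moreover have "Re (cinner x x) = (norm x)\<^sup>2"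
    by (simp add: inner_eq_Re_cinner[symmetric] power2_norm_eq_inner)
  ultimately show ?thesis by (simp add: complex_eq_iff)
qed

lemma cinner_dagger: "cinner x (A *v y) = cinner (dagger A *v x) y"
proof -
  have "cinner x (A *v y) = (\<Sum>i\<in>UNIV. \<Sum>j\<in>UNIV. cnj (x $ i) * (A $ i $ j * y $ j))"
    by (simp add: cinner_def matrix_vector_mult_def sum_distrib_left)
  also have "\<dots> = (\<Sum>j\<in>UNIV. \<Sum>i\<in>UNIV. cnj (x $ i) * (A $ i $ j * y $ j))"
    by (rule sum.swap)
  also have "\<dots> = cinner (dagger A *v x) y"
    by (simp add: cinner_def matrix_vector_mult_def dagger_def sum_distrib_right sum_distrib_left mult_ac)
  finally show ?thesis .
qed

lemma scaleR_eq_vector_smult: "r *\<^sub>R x = complex_of_real r *s (x :: complex ^ 'n)"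
  by (simp add: vec_eq_iff scaleR_conv_of_real[where 'a = complex])

lemma cinner_scaleR: "cinner x (r *\<^sub>R y) = of_real r * cinner x y"
  by (simp add: scaleR_eq_vector_smult cinner_simps)

lemma linear_matrix_vector: "linear ((*v) (A :: complex ^ 'n::finite ^ 'n))"
  by (intro linearI) (simp_all add: matrix_vector_right_distrib scaleR_eq_vector_smult
     matrix_vector_mult_def vec_eq_iff sum_distrib_left algebra_simps sum.distrib)

text \<open>Maximise the quadratic form on the unit sphere of the subspace; the first variation at a
  maximiser \<open>x\<close> in the direction \<open>f x - \<mu> x\<close> vanishes only if \<open>x\<close> is an eigenvector.\<close>

lemma selfadjoint_eigenvector_in_subspace:
  fixes f :: "'a::euclidean_space \<Rightarrow> 'a"
  assumes lin: "linear f" and sa: "\<And>x y. x \<bullet> f y = f x \<bullet> y"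
    and S: "subspace S" and inv: "\<And>x. x \<in> S \<Longrightarrow> f x \<in> S" and ne: "x0 \<in> S" "x0 \<noteq> 0"
  obtains x \<mu> where "x \<in> S" "norm x = 1" "f x = \<mu> *\<^sub>R x"
proof -
  define K where "K = S \<inter> sphere 0 1"
  have "compact K"
    unfolding K_def by (intro closed_Int_compact closed_subspace S compact_sphere)
  moreover have "(1 / norm x0) *\<^sub>R x0 \<in> K"
    using ne S by (auto simp: K_def subspace_scale)
  moreover have "continuous_on K (\<lambda>x. x \<bullet> f x)"
    by (intro continuous_intros linear_continuous_on linear_conv_bounded_linear[THEN iffD1] lin)
  ultimately obtain x where x: "x \<in> K" and max: "\<And>y. y \<in> K \<Longrightarrow> y \<bullet> f y \<le> x \<bullet> f x"
    using continuous_attains_sup[of K] by blast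
  define \<mu> where "\<mu> = x \<bullet> f x"
  define g where "g y = \<mu> * (y \<bullet> y) - y \<bullet> f y" for y
  have xx: "x \<bullet> x = 1" and xS: "x \<in> S"
    using x by (auto simp: K_def norm_eq_1)
  have gpos: "g y \<ge> 0" if "y \<in> S" for y
  proof (cases "y = 0")
    case True then show ?thesis by (simp add: g_def)
  next
    case False
    have "(1 / norm y) *\<^sub>R y \<in> K"
      using False that S by (auto simp: K_def subspace_scale)
    from max[OF this] have "(y \<bullet> f y) / (norm y)\<^sup>2 \<le> \<mu>"
      by (simp add: \<mu>_def linear_scale[OF lin] power2_eq_square field_simps)
    then show ?thesis
      using False by (simp add: g_def power2_norm_eq_inner[symmetric] field_simps)
  qed
  define z where "z = f x - \<mu> *\<^sub>R x"
  have zS: "z \<in> S"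
    unfolding z_def using S xS inv by (intro subspace_diff subspace_scale) auto
  have zz: "z \<bullet> z = z \<bullet> f x - \<mu> * (z \<bullet> x)"
    by (subst (2) z_def) (simp add: inner_diff_right)
  have "g (x + s *\<^sub>R z) = s\<^sup>2 * g z - 2 * s * (z \<bullet> z)" for s
  proof -
    have "x \<bullet> f z = z \<bullet> f x" using sa[of x z] by (simp add: inner_commute)
    then show ?thesis
      unfolding zz unfolding g_def \<mu>_def linear_add[OF lin] linear_scale[OF lin]
      using xx
      by (simp add: inner_add_left inner_add_right algebra_simps power2_eq_square inner_commute[of x z])
  qed
  note g_line = this
  have "z = 0"
  proof (rule ccontr)
    assume "z \<noteq> 0"
    then have pos: "z \<bullet> z > 0" by simp
    have gz: "g z \<ge> 0" by (rule gpos[OF zS])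
    define s where "s = (z \<bullet> z) / (g z + 1)"
    have s: "s > 0" using pos gz by (simp add: s_def)
    have "s * g z \<le> z \<bullet> z"
      using pos gz by (simp add: s_def field_simps)
    then have "s * (s * g z) \<le> s * (z \<bullet> z)" using s by simp
    moreover have "0 \<le> s\<^sup>2 * g z - 2 * s * (z \<bullet> z)"
      using gpos[of "x + s *\<^sub>R z"] g_line S xS zS by (simp add: subspace_add subspace_scale)
    ultimately have "s * (z \<bullet> z) \<le> 0" by (simp add: power2_eq_square algebra_simps)
    then show False using s pos by (simp add: mult_le_0_iff)
  qed
  then have "f x = \<mu> *\<^sub>R x" by (simp add: z_def)
  moreover have "norm x = 1" using x by (simp add: K_def)
  ultimately show thesis using that xS by blast
qed

definition onb :: "('n::finite \<Rightarrow> complex ^ 'n) \<Rightarrow> bool" where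
  "onb v \<longleftrightarrow> (\<forall>i j. cinner (v i) (v j) = (if i = j then 1 else 0))"

text \<open>As long as an orthonormal family of eigenvectors of a Hermitian matrix has fewer than \<open>n\<close> members,
  its orthogonal complement is a nonzero invariant subspace and provides one more eigenvector.\<close>

lemma orthonormal_eigenvectors:
  fixes A :: "'n::finite cmat"
  assumes A: "dagger A = A" and "k \<le> CARD('n)"
  shows "\<exists>B. finite B \<and> card B = k \<and> (\<forall>x\<in>B. \<exists>\<mu>. A *v x = complex_of_real \<mu> *s x)
           \<and> (\<forall>x\<in>B. \<forall>y\<in>B. cinner x y = (if x = y then 1 else 0))"
  using \<open>k \<le> CARD('n)\<close>
proof (induction k)
  case 0
  then show ?case by (intro exI[of _ "{}"]) simp
next
  case (Suc k)
  then obtain B where B: "finite B" "card B = k"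
    and eig: "\<And>x. x \<in> B \<Longrightarrow> \<exists>\<mu>. A *v x = complex_of_real \<mu> *s x"
    and orth: "\<And>x y. x \<in> B \<Longrightarrow> y \<in> B \<Longrightarrow> cinner x y = (if x = y then 1 else 0)"
    by (metis Suc_leD)
  define S where "S = {x. \<forall>b\<in>B. cinner b x = 0}"
  have S: "subspace S"
    by (auto simp: S_def subspace_def cinner_simps cinner_scaleR)
  have inv: "A *v x \<in> S" if "x \<in> S" for x
    unfolding S_def
  proof clarify
    fix b assume b: "b \<in> B"
    then obtain \<mu> where "A *v b = complex_of_real \<mu> *s b" using eig by blast
    then show "cinner b (A *v x) = 0"
      using that b by (simp add: cinner_dagger[of b] A cinner_simps S_def)
  qed
  \<comment> \<open>Complex orthogonality to \<open>b\<close> is real orthogonality to both \<open>b\<close> and \<open>\<i> b\<close>.\<close>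
  define U where "U = B \<union> (\<lambda>b. \<i> *s b) ` B"
  have "card U \<le> card B + card B"
    unfolding U_def using card_image_le[OF B(1), of "\<lambda>b. \<i> *s b"] card_Un_le le_trans add_left_mono by blast
  then have "dim (span U) < DIM(complex ^ 'n)"
    using B Suc.prems dim_le_card'[of U] by (simp add: dim_span U_def)
  then obtain x0 where x0: "x0 \<noteq> 0" "\<And>y. y \<in> span U \<Longrightarrow> orthogonal x0 y"
    using orthogonal_to_subspace_exists[of "span U"] by (auto simp: span_span)
  have "cinner b x0 = 0" if b: "b \<in> B" for b
  proof -
    have "b \<bullet> x0 = 0" "(\<i> *s b) \<bullet> x0 = 0"
      using x0(2)[of b] x0(2)[of "\<i> *s b"] b
      by (auto simp: U_def orthogonal_def inner_commute intro: span_base)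
    then show ?thesis by (simp add: inner_eq_Re_cinner cinner_simps complex_eq_iff)
  qed
  then have "x0 \<in> S" by (simp add: S_def)
  moreover have "x \<bullet> (A *v y) = (A *v x) \<bullet> y" for x y
    by (simp add: inner_eq_Re_cinner cinner_dagger[of x] A)
  ultimately obtain x \<mu> where x: "x \<in> S" "norm x = 1" "A *v x = \<mu> *\<^sub>R x"
    using selfadjoint_eigenvector_in_subspace[OF linear_matrix_vector _ S inv _ x0(1)] by metis
  have xx: "cinner x x = 1" using x by (simp add: cinner_same)
  have xB: "cinner b x = 0" "cinner x b = 0" if "b \<in> B" for b
    using x that cnj_cinner[of b x] by (auto simp: S_def)
  then have "x \<notin> B" using xx by force
  then show ?case
    using B eig orth x xx xB
    by (intro exI[of _ "insert x B"]) (auto simp: scaleR_eq_vector_smult)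
qed

lemma hermitian_spectral:
  fixes A :: "'n::finite cmat"
  assumes "dagger A = A"
  obtains v \<mu> where "onb v" "\<And>i. A *v v i = complex_of_real (\<mu> i) *s v i"
proof -
  obtain B where B: "finite B" "card B = CARD('n)"
    and eig: "\<And>x. x \<in> B \<Longrightarrow> \<exists>\<mu>. A *v x = complex_of_real \<mu> *s x"
    and orth: "\<And>x y. x \<in> B \<Longrightarrow> y \<in> B \<Longrightarrow> cinner x y = (if x = y then 1 else 0)"
    using orthonormal_eigenvectors[OF assms order_refl] by blast
  obtain v where v: "bij_betw v (UNIV :: 'n set) B"
    using B by (metis finite_same_card_bij finite_class.finite_UNIV)
  then have vB: "v i \<in> B" and inj: "v i = v j \<longleftrightarrow> i = j" for i j
    by (auto simp: bij_betw_def inj_def)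
  obtain \<mu> where "\<And>i. A *v v i = complex_of_real (\<mu> i) *s v i"
    using eig[OF vB] by metis
  moreover have "onb v"
    by (simp add: onb_def orth vB inj)
  ultimately show thesis using that by blast
qed

text \<open>A one-sided inverse of a square matrix is two-sided; hence an orthonormal family indexed by
  \<open>'n\<close> is complete.\<close>

lemma onb_matrix:
  fixes v :: "'n::finite \<Rightarrow> complex ^ 'n"
  assumes "onb v"
  defines "V \<equiv> (\<chi> a i. v i $ a)"
  shows "dagger V ** V = mat 1" "V ** dagger V = mat 1"
proof -
  show "dagger V ** V = mat 1"
    using assms by (simp add: onb_def cinner_def vec_eq_iff matrix_matrix_mult_def dagger_def mat_def)
  then show "V ** dagger V = mat 1"
    by (simp add: matrix_left_right_inverse)
qed

lemma onb_matrix_eqI: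
  fixes X Y :: "'n::finite cmat"
  assumes "onb v" and eq: "\<And>i. X *v v i = Y *v v i"
  shows "X = Y"
proof -
  define V where "V = (\<chi> a i. v i $ a)"
  have "X ** V = Y ** V"
    using eq by (simp add: V_def matrix_matrix_mult_def matrix_vector_mult_def vec_eq_iff)
  then have "X ** (V ** dagger V) = Y ** (V ** dagger V)"
    by (simp add: matrix_mul_assoc)
  then show ?thesis
    using onb_matrix(2)[OF assms(1)] by (simp add: V_def)
qed

lemma onb_trace:
  fixes X :: "'n::finite cmat"
  assumes "onb v"
  shows "trace X = (\<Sum>i\<in>UNIV. cinner (v i) (X *v v i))"
proof -
  define V where "V = (\<chi> a i. v i $ a)"
  have "trace X = trace (X ** (V ** dagger V))"
    using onb_matrix(2)[OF assms(1)] by (simp add: V_def)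
  also have "\<dots> = trace (dagger V ** (X ** V))"
    by (metis trace_mul_sym matrix_mul_assoc)
  also have "\<dots> = (\<Sum>i\<in>UNIV. cinner (v i) (X *v v i))"
    by (simp add: trace_def cinner_def V_def matrix_matrix_mult_def matrix_vector_mult_def dagger_def)
  finally show ?thesis .
qed

text \<open>\<open>\<Sum>i. \<mu> i \<bar>v i\<rangle>\<langle>v i\<bar>\<close>; replacing \<open>\<mu>\<close> by \<open>f \<circ> \<mu>\<close> is the functional calculus, which
  supplies square roots and positive and negative parts.\<close>

definition spectral_sum :: "('n::finite \<Rightarrow> complex ^ 'n) \<Rightarrow> ('n \<Rightarrow> real) \<Rightarrow> 'n cmat" where
  "spectral_sum v \<mu> = (\<chi> a b. \<Sum>i\<in>UNIV. complex_of_real (\<mu> i) * v i $ a * cnj (v i $ b))"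

lemma spectral_sum_mult_vec: "spectral_sum v \<mu> *v x = (\<Sum>i\<in>UNIV. (complex_of_real (\<mu> i) * cinner (v i) x) *s v i)"
  unfolding spectral_sum_def matrix_vector_mult_def cinner_def vec_eq_iff
  by (auto simp add: sum_distrib_left sum_distrib_right mult_ac intro: sum.swap)

lemma dagger_spectral_sum [simp]: "dagger (spectral_sum v \<mu>) = spectral_sum v \<mu>"
  by (simp add: dagger_def spectral_sum_def vec_eq_iff mult_ac)

lemma spectral_sum_eigen:
  assumes "onb v"
  shows "spectral_sum v \<mu> *v v j = complex_of_real (\<mu> j) *s v j"
proof -
  have "(complex_of_real (\<mu> i) * cinner (v i) (v j)) *s v i = (if i = j then complex_of_real (\<mu> j) *s v j else 0)" for i
    using assms by (auto simp: onb_def)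
  then show ?thesis by (simp add: spectral_sum_mult_vec)
qed

lemma cinner_sum: "cinner x (sum f I) = (\<Sum>i\<in>I. cinner x (f i))"
  by (induction I rule: infinite_finite_induct) (auto simp: cinner_simps)

lemma cinner_spectral_sum:
  "cinner x (spectral_sum v \<mu> *v x) = complex_of_real (\<Sum>i\<in>UNIV. \<mu> i * (cmod (cinner (v i) x))\<^sup>2)"
proof -
  have "cinner (v i) x * cinner x (v i) = complex_of_real ((cmod (cinner (v i) x))\<^sup>2)" for i
    by (metis complex_norm_square cnj_cinner)
  then show ?thesis
    by (simp add: spectral_sum_mult_vec cinner_sum cinner_simps mult.assoc)
qed

lemma psd_iff: "psd A \<longleftrightarrow> dagger A = A \<and> (\<forall>x. 0 \<le> Re (cinner x (A *v x)))"
  by (simp add: psd_def cinner_def)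

lemma psd_spectral_sum: "(\<And>i. 0 \<le> \<mu> i) \<Longrightarrow> psd (spectral_sum v \<mu>)"
  by (auto simp: psd_iff cinner_spectral_sum intro!: sum_nonneg mult_nonneg_nonneg)

lemma spectral_sum_eqI:
  assumes "onb v" "\<And>i. A *v v i = complex_of_real (\<mu> i) *s v i"
  shows "A = spectral_sum v \<mu>"
  using assms by (intro onb_matrix_eqI[OF assms(1)]) (simp add: spectral_sum_eigen)

lemma trace_spectral_sum: "onb v \<Longrightarrow> trace (spectral_sum v \<mu>) = complex_of_real (\<Sum>i\<in>UNIV. \<mu> i)"
  by (simp add: onb_trace spectral_sum_eigen cinner_simps onb_def)

lemma spectral_sum_mult:
  assumes "onb v"
  shows "spectral_sum v \<mu> ** spectral_sum v \<nu> = spectral_sum v (\<lambda>i. \<mu> i * \<nu> i)"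
  using assms by (intro spectral_sum_eqI)
    (simp_all add: matrix_vector_mul_assoc[symmetric] spectral_sum_eigen matrix_vector_mult_scaleR vector_scalar_commute vector_smult_assoc mult_ac)

lemma spectral_sum_diff: "spectral_sum v \<mu> - spectral_sum v \<nu> = spectral_sum v (\<lambda>i. \<mu> i - \<nu> i)"
  by (simp add: spectral_sum_def vec_eq_iff algebra_simps sum_subtractf)

lemma hermitian_cinner_real:
  assumes "dagger A = A"
  shows "cinner x (A *v x) = complex_of_real (Re (cinner x (A *v x)))"
proof -
  have "cnj (cinner x (A *v x)) = cinner x (A *v x)"
    by (metis assms cinner_dagger cnj_cinner)
  then show ?thesis by (metis complex_cnj_cancel_iff Reals_cnj_iff of_real_Re)
qed

lemma psd_spectral_sumE:
  assumes "psd P"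
  obtains v \<nu> where "onb v" "P = spectral_sum v \<nu>" "\<And>i. 0 \<le> \<nu> i"
proof -
  obtain v \<nu> where v: "onb v" "\<And>i. P *v v i = complex_of_real (\<nu> i) *s v i"
    using assms hermitian_spectral psd_iff by metis
  have "0 \<le> \<nu> i" for i
  proof -
    have "0 \<le> Re (cinner (v i) (P *v v i))" using assms psd_iff by blast
    also have "\<dots> = \<nu> i" using v(1) by (simp add: v(2) cinner_simps onb_def)
    finally show ?thesis .
  qed
  then show thesis using that v spectral_sum_eqI[OF v] by blast
qed

text \<open>In an orthonormal eigenbasis \<open>\<langle>x, P x\<rangle> = \<Sum>i. \<nu> i \<bar>\<langle>v i, x\<rangle>\<bar>\<^sup>2\<close> with nonnegative terms.\<close>

lemma psd_kernel:
  assumes "psd P" "Re (cinner x (P *v x)) = 0"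
  shows "P *v x = 0"
proof -
  obtain v \<nu> where v: "onb v" "P = spectral_sum v \<nu>" "\<And>i. 0 \<le> \<nu> i"
    using assms psd_spectral_sumE by metis
  have "(\<Sum>i\<in>UNIV. \<nu> i * (cmod (cinner (v i) x))\<^sup>2) = 0"
    using assms(2) by (simp add: v(2) cinner_spectral_sum)
  then have "\<nu> i * (cmod (cinner (v i) x))\<^sup>2 = 0" for i
    using v(3) by (subst (asm) sum_nonneg_eq_0_iff) auto
  then show ?thesis
    unfolding v(2) spectral_sum_mult_vec by (intro sum.neutral) auto
qed

lemma onb_norm:
  assumes "onb v"
  shows "norm (v i) = 1"
proof -
  have "complex_of_real ((norm (v i))\<^sup>2) = 1"
    using assms cinner_same[of "v i"] by (simp add: onb_def)
  then have "(norm (v i))\<^sup>2 = 1" by (simp only: of_real_eq_1_iff)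
  then show ?thesis using norm_ge_zero[of "v i"] by (auto simp: power2_eq_1_iff)
qed

lemma psd_entry_le_trace:
  assumes "psd P"
  shows "cmod (P $ a $ b) \<le> Re (trace P)"
proof -
  obtain v \<nu> where v: "onb v" "P = spectral_sum v \<nu>" "\<And>i. 0 \<le> \<nu> i"
    using assms psd_spectral_sumE by metis
  have "cmod (P $ a $ b) \<le> (\<Sum>i\<in>UNIV. cmod (complex_of_real (\<nu> i) * v i $ a * cnj (v i $ b)))"
    unfolding v(2) spectral_sum_def by (simp add: norm_sum)
  also have "\<dots> \<le> (\<Sum>i\<in>UNIV. \<nu> i)"
  proof (rule sum_mono)
    fix i
    have "cmod (v i $ a) * cmod (v i $ b) \<le> 1 * 1"
      using Finite_Cartesian_Product.norm_nth_le[of "v i"] onb_norm[OF v(1)] by (intro mult_mono) auto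
    then show "cmod (complex_of_real (\<nu> i) * v i $ a * cnj (v i $ b)) \<le> \<nu> i"
      using v(3)[of i] by (simp add: norm_mult mult.assoc mult_left_le)
  qed
  also have "\<dots> = Re (trace P)" using v by (simp add: trace_spectral_sum)
  finally show ?thesis .
qed

text \<open>If \<open>P\<^sup>2 = Q\<^sup>2\<close> and \<open>(P - Q) x = \<mu> x\<close>, then
  \<open>0 = \<langle>x, (P (P - Q) + (P - Q) Q) x\<rangle> = \<mu> (\<langle>x, P x\<rangle> + \<langle>x, Q x\<rangle>)\<close>; for \<open>\<mu> \<noteq> 0\<close> positivity makes both
  forms vanish at \<open>x\<close>, so that \<open>\<mu> \<parallel>x\<parallel>\<^sup>2 = 0\<close>.\<close>

lemma psd_square_inj:
  fixes P Q :: "'n::finite cmat"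
  assumes P: "psd P" and Q: "psd Q" and eq: "P ** P = Q ** Q"
  shows "P = Q"
proof -
  have herm: "dagger P = P" "dagger Q = Q" using P Q by (auto simp: psd_iff)
  then have "dagger (P - Q) = P - Q" by (simp add: dagger_def vec_eq_iff)
  then obtain v \<mu> where v: "onb v" "\<And>i. (P - Q) *v v i = complex_of_real (\<mu> i) *s v i"
    using hermitian_spectral by metis
  have "\<mu> i = 0" for i
  proof (rule ccontr)
    assume ne: "\<mu> i \<noteq> 0"
    let ?x = "v i"
    have PQ: "P *v ?x - Q *v ?x = complex_of_real (\<mu> i) *s ?x"
      using v(2)[of i] by (simp add: matrix_vector_mult_diff_rdistrib)
    have *: "cinner y (P *v ?x) = cinner y (Q *v ?x) + complex_of_real (\<mu> i) * cinner y ?x" for y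
      using PQ by (metis cinner_simps(2) cinner_simps(3) diff_add_cancel add.commute)
    have "cinner (P *v ?x) (P *v ?x) = cinner (Q *v ?x) (Q *v ?x)"
      using eq herm by (metis cinner_dagger matrix_vector_mul_assoc)
    moreover have "cinner (P *v ?x) (P *v ?x) = cinner (P *v ?x) (Q *v ?x) + complex_of_real (\<mu> i) * cinner ?x (P *v ?x)"
      using * herm by (metis cinner_dagger)
    moreover have "cinner (P *v ?x) (Q *v ?x) = cinner (Q *v ?x) (Q *v ?x) + complex_of_real (\<mu> i) * cinner ?x (Q *v ?x)"
    proof -
      have "cnj (cinner (Q *v ?x) (P *v ?x)) = cnj (cinner (Q *v ?x) (Q *v ?x)) + complex_of_real (\<mu> i) * cnj (cinner (Q *v ?x) ?x)"
        using *[of "Q *v ?x"] by simp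
      then show ?thesis by (simp add: cnj_cinner)
    qed
    ultimately have "complex_of_real (\<mu> i) * (cinner ?x (P *v ?x) + cinner ?x (Q *v ?x)) = 0"
      by (simp add: algebra_simps)
    then have "cinner ?x (P *v ?x) + cinner ?x (Q *v ?x) = 0"
      using ne by simp
    then have "Re (cinner ?x (P *v ?x)) + Re (cinner ?x (Q *v ?x)) = 0"
      by (metis plus_complex.sel(1) zero_complex.sel(1))
    moreover have "Re (cinner ?x (P *v ?x)) \<ge> 0" "Re (cinner ?x (Q *v ?x)) \<ge> 0"
      using P Q by (auto simp: psd_iff)
    ultimately have "P *v ?x = 0" "Q *v ?x = 0"
      using psd_kernel[OF P] psd_kernel[OF Q] by auto
    then have "complex_of_real (\<mu> i) * cinner ?x ?x = 0"
      using *[of ?x] by (simp add: cinner_simps)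
    then show False using ne v(1) by (simp add: onb_def)
  qed
  then have "P - Q = spectral_sum v (\<lambda>_. 0)"
    using v by (intro spectral_sum_eqI) auto
  then show ?thesis by (simp add: spectral_sum_def vec_eq_iff)
qed

text \<open>By uniqueness of positive square roots, the trace norm of a Hermitian matrix is the absolute
  sum of its eigenvalues.\<close>

lemma trace_norm_spectral_sum:
  assumes "onb v"
  shows "trace_norm (spectral_sum v \<mu>) = (\<Sum>i\<in>UNIV. \<bar>\<mu> i\<bar>)"
proof -
  have sq: "spectral_sum v (\<lambda>i. \<bar>\<mu> i\<bar>) ** spectral_sum v (\<lambda>i. \<bar>\<mu> i\<bar>) = spectral_sum v \<mu> ** spectral_sum v \<mu>"
    by (simp add: spectral_sum_mult[OF assms])
  have "psd_sqrt (spectral_sum v \<mu> ** spectral_sum v \<mu>) = spectral_sum v (\<lambda>i. \<bar>\<mu> i\<bar>)"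
    unfolding psd_sqrt_def
    by (rule the_equality) (auto simp: sq psd_spectral_sum intro: psd_square_inj)
  then show ?thesis by (simp add: trace_norm_def trace_spectral_sum[OF assms])
qed

section \<open>The trace norm of Hermitian matrices\<close>

interpretation mscale: vector_space "mscale :: complex \<Rightarrow> 'n::finite cmat \<Rightarrow> 'n cmat"
  by (rule vector_space_mscale)

lemma trace_mscale: "trace (c *\<^sub>M A) = c * trace A"
  by (simp add: trace_def mscale_def sum_distrib_left)

lemma mscale_mult_vec: "(c *\<^sub>M A) *v x = c *s (A *v x)"
  by (simp add: mscale_def matrix_vector_mult_def vec_eq_iff sum_distrib_left mult_ac)

lemma scaleR_eq_mscale: "r *\<^sub>R A = complex_of_real r *\<^sub>M A"
  by (simp add: mscale_def vec_eq_iff scaleR_conv_of_real[where 'a = complex])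

lemma dagger_simps:
  "dagger (A + B) = dagger A + dagger B" "dagger (A - B) = dagger A - dagger B"
  "dagger (c *\<^sub>M A) = cnj c *\<^sub>M dagger A" "dagger (dagger A) = A" "dagger 0 = 0"
  by (simp_all add: dagger_def mscale_def vec_eq_iff)

lemma trace_dagger: "trace (dagger A) = cnj (trace A)"
  by (simp add: trace_def dagger_def)

definition herm_part :: "'n::finite cmat \<Rightarrow> 'n cmat" where
  "herm_part X = (1 / 2) *\<^sub>M (X + dagger X)"

lemma dagger_herm_part [simp]: "dagger (herm_part X) = herm_part X"
  by (simp add: herm_part_def dagger_simps add.commute)

lemma herm_part_decomp: "X = herm_part X + \<i> *\<^sub>M herm_part ((- \<i>) *\<^sub>M X)"
  by (simp add: herm_part_def dagger_simps) (simp add: mscale_def vec_eq_iff dagger_def algebra_simps)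

lemma trace_herm_part: "trace X = 0 \<Longrightarrow> trace (herm_part X) = 0"
  by (simp add: herm_part_def trace_mscale trace_add trace_dagger)

lemma hermitian_spectral_sumE:
  assumes "dagger H = H"
  obtains v \<mu> where "onb v" "H = spectral_sum v \<mu>"
  using hermitian_spectral[OF assms] spectral_sum_eqI by metis

lemma jordan_decomposition:
  fixes \<mu> :: "'n::finite \<Rightarrow> real"
  assumes "onb v"
  defines "P \<equiv> spectral_sum v (\<lambda>i. max (\<mu> i) 0)" and "Q \<equiv> spectral_sum v (\<lambda>i. max (- \<mu> i) 0)"
  shows "psd P" "psd Q" "spectral_sum v \<mu> = P - Q"
    "trace_norm (spectral_sum v \<mu>) = Re (trace P) + Re (trace Q)"
proof -
  show "psd P" "psd Q" unfolding P_def Q_def by (simp_all add: psd_spectral_sum)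
  have *: "max x 0 - max (- x) 0 = x" "max x 0 + max (- x) 0 = \<bar>x\<bar>" for x :: real by auto
  show "spectral_sum v \<mu> = P - Q" unfolding P_def Q_def by (simp add: spectral_sum_diff *)
  show "trace_norm (spectral_sum v \<mu>) = Re (trace P) + Re (trace Q)"
    unfolding P_def Q_def
    by (simp add: trace_norm_spectral_sum[OF assms(1)] trace_spectral_sum[OF assms(1)] sum.distrib[symmetric] *)
qed

lemma hermitian_psd_differenceE:
  assumes "dagger H = H"
  obtains P Q where "psd P" "psd Q" "H = P - Q" "trace_norm H = Re (trace P) + Re (trace Q)"
proof -
  obtain v \<mu> where v: "onb v" "H = spectral_sum v \<mu>" by (rule hermitian_spectral_sumE[OF assms])
  show thesis
    by (rule that) (use jordan_decomposition[OF v(1), of \<mu>] in \<open>simp_all only: v(2)\<close>)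
qed

text \<open>For an orthonormal basis \<open>v\<close> this is \<open>tr (U X)\<close> for the Hermitian \<open>U\<close> with
  eigenvalues \<open>s i\<close>. With \<open>s i = sgn (\<mu> i)\<close> it attains the trace norm, so it replaces the duality
  between trace norm and operator norm.\<close>

definition dual_form :: "('n::finite \<Rightarrow> complex ^ 'n) \<Rightarrow> ('n \<Rightarrow> real) \<Rightarrow> 'n cmat \<Rightarrow> complex" where
  "dual_form v s X = (\<Sum>i\<in>UNIV. complex_of_real (s i) * cinner (v i) (X *v v i))"

lemma dual_form_psd_le:
  assumes v: "onb v" and s: "\<And>i. \<bar>s i\<bar> \<le> 1" and P: "psd P"
  shows "cmod (dual_form v s P) \<le> Re (trace P)"
proof -
  have herm: "dagger P = P" and pos: "0 \<le> Re (cinner x (P *v x))" for x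
    using P by (auto simp: psd_iff)
  have "cmod (dual_form v s P)
      \<le> (\<Sum>i\<in>UNIV. cmod (complex_of_real (s i) * cinner (v i) (P *v v i)))"
    unfolding dual_form_def by (rule norm_sum)
  also have "\<dots> \<le> (\<Sum>i\<in>UNIV. Re (cinner (v i) (P *v v i)))"
  proof (rule sum_mono)
    fix i
    have "cmod (cinner (v i) (P *v v i)) = Re (cinner (v i) (P *v v i))"
      using pos[of "v i"] hermitian_cinner_real[OF herm, of "v i"] by (metis abs_of_nonneg norm_of_real)
    then show "cmod (complex_of_real (s i) * cinner (v i) (P *v v i)) \<le> Re (cinner (v i) (P *v v i))"
      using s[of i] pos[of "v i"] by (simp add: norm_mult mult_left_le_one_le)
  qed
  also have "\<dots> = Re (trace P)"
    by (simp add: onb_trace[OF v])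
  finally show ?thesis .
qed

lemma dual_form_diff: "dual_form v s (X - Y) = dual_form v s X - dual_form v s Y"
  by (simp add: dual_form_def matrix_vector_mult_diff_rdistrib cinner_simps algebra_simps sum_subtractf)

lemma dual_form_add: "dual_form v s (X + Y) = dual_form v s X + dual_form v s Y"
  by (simp add: dual_form_def matrix_vector_mult_add_rdistrib cinner_simps algebra_simps sum.distrib)

lemma dual_form_mscale: "dual_form v s (c *\<^sub>M X) = c * dual_form v s X"
  by (simp add: dual_form_def mscale_mult_vec cinner_simps sum_distrib_left mult_ac)

lemma bounded_linear_dual_form: "bounded_linear (dual_form v s)"
  unfolding linear_conv_bounded_linear[symmetric]
  by (intro linearI) (simp_all add: dual_form_add scaleR_eq_mscale dual_form_mscale scaleR_conv_of_real)

lemma trace_norm_attained: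
  assumes "dagger H = H"
  obtains v s where "onb v" "\<And>i. \<bar>s i\<bar> \<le> 1" "trace_norm H = Re (dual_form v s H)"
proof -
  obtain v \<mu> where v: "onb v" "H = spectral_sum v \<mu>" by (rule hermitian_spectral_sumE[OF assms])
  have "dual_form v (\<lambda>i. sgn (\<mu> i)) H = (\<Sum>i\<in>UNIV. complex_of_real (sgn (\<mu> i) * \<mu> i))"
    unfolding dual_form_def v(2) using v(1) by (simp add: spectral_sum_eigen cinner_simps onb_def)
  also have "\<dots> = complex_of_real (\<Sum>i\<in>UNIV. \<bar>\<mu> i\<bar>)"
    by (simp add: abs_sgn mult.commute)
  finally have "trace_norm H = Re (dual_form v (\<lambda>i. sgn (\<mu> i)) H)"
    by (simp add: v(2) trace_norm_spectral_sum[OF v(1)])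
  then show thesis using that[of v "\<lambda>i. sgn (\<mu> i)"] v(1) by (auto simp: sgn_real_def)
qed

lemma dual_form_le_psd_difference:
  assumes "onb v" "\<And>i. \<bar>s i\<bar> \<le> 1" "psd P" "psd Q"
  shows "cmod (dual_form v s (P - Q)) \<le> Re (trace P) + Re (trace Q)"
proof -
  have "cmod (dual_form v s (P - Q)) \<le> cmod (dual_form v s P) + cmod (dual_form v s Q)"
    by (simp add: dual_form_diff norm_triangle_ineq4)
  also have "\<dots> \<le> Re (trace P) + Re (trace Q)"
    by (intro add_mono dual_form_psd_le assms)
  finally show ?thesis .
qed

lemma dual_form_le_trace_norm:
  assumes "onb v" "\<And>i. \<bar>s i\<bar> \<le> 1" "dagger X = X"
  shows "cmod (dual_form v s X) \<le> trace_norm X"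
proof -
  obtain P Q where PQ: "psd P" "psd Q" "X = P - Q" "trace_norm X = Re (trace P) + Re (trace Q)"
    by (rule hermitian_psd_differenceE[OF assms(3)])
  show ?thesis
    using dual_form_le_psd_difference[OF assms(1,2) PQ(1,2)] by (simp only: PQ(3)[symmetric] PQ(4))
qed

lemma psd_imp_hermitian: "psd P \<Longrightarrow> dagger P = P"
  by (simp add: psd_iff)

text \<open>Together with the decomposition into positive and negative parts, this makes
  \<open>\<parallel>H\<parallel>\<^sub>1\<close> the least value of \<open>tr P + tr Q\<close> over all \<open>H = P - Q\<close> with \<open>P, Q\<close> positive semidefinite.
  Contractivity of positive trace-preserving maps and the triangle inequality both come from this.\<close>

lemma trace_norm_psd_difference_le:
  assumes "psd P" "psd Q"
  shows "trace_norm (P - Q) \<le> Re (trace P) + Re (trace Q)"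
proof -
  have "dagger (P - Q) = P - Q" using assms by (simp add: dagger_simps psd_imp_hermitian)
  then obtain v s where v: "onb v" "\<And>i. \<bar>s i\<bar> \<le> 1" "trace_norm (P - Q) = Re (dual_form v s (P - Q))"
    using trace_norm_attained by metis
  show ?thesis
    unfolding v(3) by (rule order_trans[OF complex_Re_le_cmod dual_form_le_psd_difference[OF v(1,2) assms]])
qed

lemma trace_norm_add_le:
  assumes "dagger X = X" "dagger Y = Y"
  shows "trace_norm (X + Y) \<le> trace_norm X + trace_norm Y"
proof -
  have "dagger (X + Y) = X + Y" using assms by (simp add: dagger_simps)
  then obtain v s where v: "onb v" "\<And>i. \<bar>s i\<bar> \<le> 1" "trace_norm (X + Y) = Re (dual_form v s (X + Y))"
    using trace_norm_attained by metis
  have "Re (dual_form v s X) \<le> trace_norm X" "Re (dual_form v s Y) \<le> trace_norm Y"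
    by (rule order_trans[OF complex_Re_le_cmod dual_form_le_trace_norm[OF v(1,2)]], rule assms)+
  then show ?thesis by (simp add: v(3) dual_form_add)
qed

lemma trace_norm_scale:
  assumes "dagger X = X"
  shows "trace_norm (complex_of_real r *\<^sub>M X) = \<bar>r\<bar> * trace_norm X"
proof -
  obtain v \<mu> where v: "onb v" "X = spectral_sum v \<mu>" by (rule hermitian_spectral_sumE[OF assms])
  have "complex_of_real r *\<^sub>M X = spectral_sum v (\<lambda>i. r * \<mu> i)"
    by (simp add: v(2) spectral_sum_def mscale_def vec_eq_iff sum_distrib_left mult.assoc)
  then have "trace_norm (complex_of_real r *\<^sub>M X) = (\<Sum>i\<in>UNIV. \<bar>r * \<mu> i\<bar>)"
    by (simp only: trace_norm_spectral_sum[OF v(1)])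
  then show ?thesis
    by (simp only: v(2) trace_norm_spectral_sum[OF v(1)] abs_mult sum_distrib_left)
qed

lemma hermitian_entry_le_trace_norm:
  assumes "dagger X = X"
  shows "cmod (X $ a $ b) \<le> trace_norm X"
proof -
  obtain P Q where PQ: "psd P" "psd Q" "X = P - Q" "trace_norm X = Re (trace P) + Re (trace Q)"
    by (rule hermitian_psd_differenceE[OF assms])
  have "cmod (X $ a $ b) \<le> cmod (P $ a $ b) + cmod (Q $ a $ b)"
    by (simp add: PQ(3) norm_triangle_ineq4)
  then show ?thesis
    using psd_entry_le_trace[OF PQ(1), of a b] psd_entry_le_trace[OF PQ(2), of a b] PQ(4) by linarith
qed

lemma trace_norm_pos:
  assumes "dagger X = X" "X \<noteq> 0"
  shows "trace_norm X > 0"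
proof -
  obtain a b where "X $ a $ b \<noteq> 0" using assms(2) by (auto simp: vec_eq_iff)
  then have "0 < cmod (X $ a $ b)" by simp
  then show ?thesis using hermitian_entry_le_trace_norm[OF assms(1), of a b] by linarith
qed

lemma norm_le_entry_bound:
  fixes X :: "'n::finite cmat"
  assumes "\<And>a b. cmod (X $ a $ b) \<le> C"
  shows "norm X \<le> real CARD('n) * (real CARD('n) * C)"
proof -
  have "norm X \<le> (\<Sum>a\<in>UNIV. norm (X $ a))"
    by (simp add: norm_vec_def L2_set_le_sum)
  also have "\<dots> \<le> (\<Sum>a\<in>(UNIV :: 'n set). real CARD('n) * C)"
  proof (rule sum_mono)
    fix a
    have "norm (X $ a) \<le> (\<Sum>b\<in>UNIV. norm (X $ a $ b))"
      by (simp add: norm_vec_def L2_set_le_sum)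
    also have "\<dots> \<le> (\<Sum>b\<in>(UNIV :: 'n set). C)" by (intro sum_mono assms)
    finally show "norm (X $ a) \<le> real CARD('n) * C" by simp
  qed
  finally show ?thesis by simp
qed

lemma norm_mscale: "norm (c *\<^sub>M X) = cmod c * norm X"
proof -
  have "norm ((c *\<^sub>M X) $ a) = cmod c * norm (X $ a)" for a
    by (simp add: mscale_def norm_vec_def norm_mult L2_set_right_distrib)
  then show ?thesis by (simp add: norm_vec_def[of "c *\<^sub>M X"] norm_vec_def[of X] L2_set_right_distrib)
qed

section \<open>Positive trace-preserving maps\<close>

locale positive_tp_map =
  fixes T :: "'n::finite cmat \<Rightarrow> 'n cmat"
  assumes lin: "Vector_Spaces.linear mscale mscale T"
    and tp: "trace_preserving T" and pos: "positive_map T"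
begin

sublocale T: Vector_Spaces.linear mscale mscale T by (rule lin)

lemmas T_simps = T.add T.scale T.diff T.zero

lemma pow_simps:
  "(T ^^ k) (X + Y) = (T ^^ k) X + (T ^^ k) Y" "(T ^^ k) (X - Y) = (T ^^ k) X - (T ^^ k) Y"
  "(T ^^ k) (c *\<^sub>M X) = c *\<^sub>M (T ^^ k) X" "(T ^^ k) 0 = 0"
  by (induction k) (auto simp: T_simps)

lemma trace_T [simp]: "trace (T X) = trace X"
  using tp by (simp add: trace_preserving_def)

lemma trace_pow [simp]: "trace ((T ^^ k) X) = trace X"
  by (induction k) auto

lemma psd_T: "psd X \<Longrightarrow> psd (T X)"
  using pos by (simp add: positive_map_def)

lemma hermitian_T:
  assumes "dagger X = X"
  shows "dagger (T X) = T X"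
proof -
  obtain P Q where "psd P" "psd Q" "X = P - Q" by (rule hermitian_psd_differenceE[OF assms])
  then show ?thesis by (simp add: T_simps dagger_simps psd_imp_hermitian psd_T)
qed

lemma T_dagger: "T (dagger X) = dagger (T X)"
proof -
  let ?A = "herm_part X" and ?B = "herm_part ((- \<i>) *\<^sub>M X)"
  have X: "X = ?A + \<i> *\<^sub>M ?B" by (rule herm_part_decomp)
  have "dagger X = ?A - \<i> *\<^sub>M ?B"
    by (subst X) (simp add: dagger_simps)
  then have "T (dagger X) = T ?A - \<i> *\<^sub>M T ?B" by (simp add: T_simps)
  also have "\<dots> = dagger (T ?A + \<i> *\<^sub>M T ?B)" by (simp add: dagger_simps hermitian_T)
  also have "T ?A + \<i> *\<^sub>M T ?B = T X" by (subst (3) X) (simp add: T_simps)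
  finally show ?thesis .
qed

lemma hermitian_pow: "dagger X = X \<Longrightarrow> dagger ((T ^^ k) X) = (T ^^ k) X"
  by (induction k) (auto simp: hermitian_T)

text \<open>The image of an optimal decomposition \<open>X = P - Q\<close> is a decomposition of \<open>T X\<close> with the same traces.\<close>

lemma trace_norm_T_le:
  assumes "dagger X = X"
  shows "trace_norm (T X) \<le> trace_norm X"
proof -
  obtain P Q where PQ: "psd P" "psd Q" "X = P - Q" "trace_norm X = Re (trace P) + Re (trace Q)"
    by (rule hermitian_psd_differenceE[OF assms])
  then show ?thesis
    using trace_norm_psd_difference_le[OF psd_T[OF PQ(1)] psd_T[OF PQ(2)]] by (simp add: T_simps)
qed

lemma trace_norm_pow_le: "dagger X = X \<Longrightarrow> trace_norm ((T ^^ k) X) \<le> trace_norm X"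
proof (induction k)
  case (Suc k)
  then show ?case using trace_norm_T_le[OF hermitian_pow[OF Suc.prems, of k]] by simp
qed simp

lemma power_bounded: "\<exists>C. \<forall>k. norm ((T ^^ k) X) \<le> C"
proof -
  define A B where "A = herm_part X" and "B = herm_part ((- \<i>) *\<^sub>M X)"
  have X: "X = A + \<i> *\<^sub>M B" unfolding A_def B_def by (rule herm_part_decomp)
  have herm: "dagger A = A" "dagger B = B" by (simp_all add: A_def B_def)
  have "cmod ((T ^^ k) X $ a $ b) \<le> trace_norm A + trace_norm B" for k a b
  proof -
    have "cmod ((T ^^ k) X $ a $ b) \<le> cmod ((T ^^ k) A $ a $ b) + cmod ((T ^^ k) B $ a $ b)"
      unfolding X pow_simps using norm_triangle_ineq[of "(T ^^ k) A $ a $ b" "\<i> * (T ^^ k) B $ a $ b"]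
      by (simp add: mscale_def norm_mult)
    also have "\<dots> \<le> trace_norm A + trace_norm B"
      by (intro add_mono order_trans[OF hermitian_entry_le_trace_norm trace_norm_pow_le] hermitian_pow herm)
    finally show ?thesis .
  qed
  then show ?thesis using norm_le_entry_bound by blast
qed

lemma eigenvalue_cmod_le_1:
  assumes "T X = l *\<^sub>M X" "X \<noteq> 0"
  shows "cmod l \<le> 1"
proof (rule ccontr)
  assume "\<not> cmod l \<le> 1"
  have "(T ^^ k) X = l ^ k *\<^sub>M X" for k
    by (induction k) (auto simp: T_simps assms(1) mult.commute)
  moreover obtain C where "\<And>k. norm ((T ^^ k) X) \<le> C" using power_bounded by blast
  ultimately have C: "cmod l ^ k * norm X \<le> C" for k
    by (metis norm_mscale norm_power)
  obtain k where "C / norm X < cmod l ^ k"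
    using real_arch_pow \<open>\<not> cmod l \<le> 1\<close> by (metis not_le)
  then show False using C[of k] assms(2) by (simp add: field_simps)
qed

text \<open>With \<open>H = P - Q\<close> the decomposition into positive and negative parts, the trace of \<open>T H = H\<close>
  over the range of \<open>P\<close> is already all of \<open>tr P = tr (T P)\<close>. Hence \<open>T Q\<close> vanishes on that range and
  \<open>T P\<close> on its complement, so \<open>T P = P\<close>.\<close>

lemma hermitian_fixed_psd_part:
  assumes "onb v" and fixed: "T (spectral_sum v \<mu>) = spectral_sum v \<mu>"
  shows "T (spectral_sum v (\<lambda>i. max (\<mu> i) 0)) = spectral_sum v (\<lambda>i. max (\<mu> i) 0)"
proof -
  define P Q where "P = spectral_sum v (\<lambda>i. max (\<mu> i) 0)" and "Q = spectral_sum v (\<lambda>i. max (- \<mu> i) 0)"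
  have psd: "psd P" "psd Q" and H: "spectral_sum v \<mu> = P - Q"
    unfolding P_def Q_def by (rule jordan_decomposition[OF assms(1)])+
  have TPQ: "T P - T Q = spectral_sum v \<mu>" using fixed unfolding H by (simp add: T_simps)
  define p q where "p i = Re (cinner (v i) (T P *v v i))" and "q i = Re (cinner (v i) (T Q *v v i))" for i
  have p0: "p i \<ge> 0" and q0: "q i \<ge> 0" for i
    using psd[THEN psd_T] by (auto simp: p_def q_def psd_iff)
  have pq: "p i - q i = \<mu> i" for i
  proof -
    have "cinner (v i) ((T P - T Q) *v v i) = of_real (\<mu> i)"
      unfolding TPQ using assms(1) by (simp add: spectral_sum_eigen cinner_simps onb_def)
    then have "Re (cinner (v i) ((T P - T Q) *v v i)) = \<mu> i" by simp
    then show ?thesis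
      by (simp add: p_def q_def matrix_vector_mult_diff_rdistrib cinner_simps)
  qed
  have "Re (trace (T P)) = (\<Sum>i\<in>UNIV. p i)"
    by (simp only: onb_trace[OF assms(1), of "T P"] p_def Re_sum)
  then have "(\<Sum>i\<in>UNIV. p i - max (\<mu> i) 0) = 0"
    by (simp add: P_def trace_spectral_sum[OF assms(1)] sum_subtractf)
  moreover have "p i - max (\<mu> i) 0 \<ge> 0" for i
    using p0[of i] q0[of i] pq[of i] by auto
  ultimately have p: "p i = max (\<mu> i) 0" for i
    by (subst (asm) sum_nonneg_eq_0_iff) auto
  then have q: "q i = max (- \<mu> i) 0" for i
    using pq[of i] by (auto simp: max_def)
  have "T P *v v i = complex_of_real (max (\<mu> i) 0) *s v i" for i
  proof (cases "\<mu> i > 0")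
    case True
    then have "T Q *v v i = 0"
      using q[of i] psd psd_T by (intro psd_kernel) (auto simp: q_def)
    moreover have "T P *v v i - T Q *v v i = complex_of_real (\<mu> i) *s v i"
      using TPQ spectral_sum_eigen[OF assms(1), of \<mu> i] by (simp add: matrix_vector_mult_diff_rdistrib[symmetric])
    ultimately show ?thesis using True by simp
  next
    case False
    then have "T P *v v i = 0"
      using p[of i] psd psd_T by (intro psd_kernel) (auto simp: p_def)
    then show ?thesis using False by (simp add: max_def)
  qed
  then have "T P = spectral_sum v (\<lambda>i. max (\<mu> i) 0)"
    by (rule spectral_sum_eqI[OF assms(1)])
  then show ?thesis by (simp add: P_def)
qed

lemma psd_fixed_eq_stationary:
  assumes unique: "\<exists>!\<rho>. stationary_state T \<rho>" and "stationary_state T \<rho>"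
    and "psd P" "T P = P"
  shows "P = trace P *\<^sub>M \<rho>"
proof (cases "trace P = 0")
  case True
  then have "cmod (P $ a $ b) \<le> 0" for a b
    using psd_entry_le_trace[OF assms(3), of a b] by simp
  then show ?thesis using True by (simp add: vec_eq_iff)
next
  case False
  have tr: "trace P = complex_of_real (Re (trace P))"
  proof -
    have "cnj (trace P) = trace P" using trace_dagger[of P] psd_imp_hermitian[OF assms(3)] by simp
    then show ?thesis by (metis Reals_cnj_iff of_real_Re)
  qed
  have "0 \<le> Re (trace P)" using psd_entry_le_trace[OF assms(3), of undefined undefined]
    by (rule order_trans[OF norm_ge_zero])
  have "psd (complex_of_real (1 / Re (trace P)) *\<^sub>M P)"
    using assms(3) \<open>0 \<le> Re (trace P)\<close>
    by (auto simp: psd_iff dagger_simps mscale_mult_vec cinner_simps simp flip: of_real_divide)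
  moreover have "complex_of_real (1 / Re (trace P)) = 1 / trace P" by (subst (2) tr) simp
  ultimately have "stationary_state T ((1 / trace P) *\<^sub>M P)"
    using False assms(4) by (simp add: stationary_state_def T_simps trace_mscale)
  then have "(1 / trace P) *\<^sub>M P = \<rho>" using unique assms(2) by blast
  then show ?thesis using False by auto
qed

text \<open>The positive and negative parts of a Hermitian traceless fixed point are both fixed, hence both
  are the same multiple of the stationary state; general matrices split into Hermitian ones.\<close>

lemma traceless_fixed_eq_0:
  assumes unique: "\<exists>!\<rho>. stationary_state T \<rho>" and "T X = X" "trace X = 0"
  shows "X = 0"
proof -
  obtain \<rho> where \<rho>: "stationary_state T \<rho>" using unique by blast
  have herm: "H = 0" if H: "dagger H = H" "T H = H" "trace H = 0" for H
  proof -
    obtain v \<mu> where v: "onb v" "H = spectral_sum v \<mu>" by (rule hermitian_spectral_sumE[OF H(1)])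
    define P Q where "P = spectral_sum v (\<lambda>i. max (\<mu> i) 0)" and "Q = spectral_sum v (\<lambda>i. max (- \<mu> i) 0)"
    have psd: "psd P" "psd Q" and PQ: "H = P - Q"
      unfolding P_def Q_def v(2) by (rule jordan_decomposition[OF v(1)])+
    have "T P = P" using hermitian_fixed_psd_part v H(2) unfolding P_def by blast
    moreover have "T Q = Q"
      using \<open>T P = P\<close> H(2) unfolding PQ T_simps by simp
    ultimately have "P = trace P *\<^sub>M \<rho>" "Q = trace Q *\<^sub>M \<rho>"
      using psd_fixed_eq_stationary[OF unique \<rho>] psd by auto
    moreover have "trace P = trace Q" using H(3) by (simp add: PQ trace_sub)
    ultimately show "H = 0" unfolding PQ by (metis diff_self)
  qed
  have herm_part0: "herm_part Y = 0" if "T Y = Y" "trace Y = 0" for Y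
  proof (rule herm)
    show "T (herm_part Y) = herm_part Y" by (simp add: herm_part_def T_simps T_dagger that)
  qed (simp_all add: trace_herm_part that)
  have "herm_part ((- \<i>) *\<^sub>M X) = 0"
    by (rule herm_part0) (simp_all only: T_simps trace_mscale assms(2,3) mult_zero_right)
  moreover have "herm_part X = 0" by (rule herm_part0[OF assms(2,3)])
  ultimately show ?thesis using herm_part_decomp[of X] by simp
qed

end

section \<open>Blaschke products as formal power series\<close>

definition energy :: "nat \<Rightarrow> complex fps \<Rightarrow> real" where
  "energy K F = (\<Sum>k\<le>K. (cmod (fps_nth F k))\<^sup>2)"

lemma linear_factor_nth:
  fixes F :: "complex fps"
  shows "fps_nth ((fps_X - fps_const a) * F) 0 = - a * fps_nth F 0"
    "fps_nth ((fps_X - fps_const a) * F) (Suc k) = fps_nth F k - a * fps_nth F (Suc k)"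
    "fps_nth ((1 - fps_const b * fps_X) * F) 0 = fps_nth F 0"
    "fps_nth ((1 - fps_const b * fps_X) * F) (Suc k) = fps_nth F (Suc k) - b * fps_nth F k"
  by (simp_all add: left_diff_distrib mult.assoc)

lemma cmod_diff_swap:
  "(cmod (z - a * w))\<^sup>2 + (1 - (cmod a)\<^sup>2) * (cmod w)\<^sup>2 = (cmod (w - cnj a * z))\<^sup>2 + (1 - (cmod a)\<^sup>2) * (cmod z)\<^sup>2"
  unfolding cmod_power2 by (simp add: algebra_simps power2_eq_square)

text \<open>On the unit circle \<open>\<bar>z - a\<bar> = \<bar>1 - cnj a z\<bar>\<close>, so both factors have the same effect on the
  \<open>\<ell>\<^sup>2\<close> norm of the coefficients. The termwise differences telescope, which yields an identity for
  partial sums and thus an inequality for arbitrary formal power series, convergent or not.\<close>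

lemma energy_factor_eq:
  "energy K ((fps_X - fps_const a) * F) + (1 - (cmod a)\<^sup>2) * (cmod (fps_nth F K))\<^sup>2
     = energy K ((1 - fps_const (cnj a) * fps_X) * F)"
proof (induction K)
  case 0
  show ?case by (simp add: energy_def linear_factor_nth norm_mult power_mult_distrib algebra_simps)
next
  case (Suc K)
  then show ?case
    using cmod_diff_swap[of "fps_nth F K" a "fps_nth F (Suc K)"]
    by (simp add: energy_def linear_factor_nth del: fps_mult_nth_0)
qed

definition lin_prod :: "complex list \<Rightarrow> complex fps" where
  "lin_prod as = prod_list (map (\<lambda>a. fps_X - fps_const a) as)"

definition rev_prod :: "complex list \<Rightarrow> complex fps" where
  "rev_prod as = prod_list (map (\<lambda>a. 1 - fps_const (cnj a) * fps_X) as)"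

lemma energy_lin_prod_le:
  assumes "\<And>a. a \<in> set as \<Longrightarrow> cmod a \<le> 1"
  shows "energy K (lin_prod as * F) \<le> energy K (rev_prod as * F)"
  using assms
proof (induction as arbitrary: F)
  case Nil
  then show ?case by (simp add: lin_prod_def rev_prod_def)
next
  case (Cons a as)
  have "(cmod a)\<^sup>2 \<le> 1" using Cons.prems[of a] by (simp add: power_le_one)
  then have "energy K ((fps_X - fps_const a) * (lin_prod as * F))
      \<le> energy K ((1 - fps_const (cnj a) * fps_X) * (lin_prod as * F))"
    using energy_factor_eq[of K a "lin_prod as * F"]
    by (smt (verit) mult_nonneg_nonneg zero_le_power2)
  also have "\<dots> = energy K (lin_prod as * ((1 - fps_const (cnj a) * fps_X) * F))"
    by (simp only: mult.left_commute)
  also have "\<dots> \<le> energy K (rev_prod as * ((1 - fps_const (cnj a) * fps_X) * F))"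
    using Cons by auto
  finally show ?case by (simp add: lin_prod_def rev_prod_def mult_ac)
qed

text \<open>The Taylor series at \<open>0\<close> of the Blaschke product \<open>\<Prod>a. (z - a) / (1 - cnj a z)\<close>.\<close>

definition blaschke :: "complex list \<Rightarrow> complex fps" where
  "blaschke as = lin_prod as * inverse (rev_prod as)"

lemma rev_prod_nth_0: "fps_nth (rev_prod as) 0 = 1"
  by (induction as) (auto simp: rev_prod_def)

lemma rev_prod_inverse: "rev_prod as * inverse (rev_prod as) = 1"
  by (metis rev_prod_nth_0 inverse_mult_eq_1 mult.commute zero_neq_one)

lemma blaschke_mult_rev_prod: "blaschke as * rev_prod as = lin_prod as"
  using rev_prod_inverse[of as] by (simp add: blaschke_def mult_ac)

lemma energy_blaschke_le:
  assumes "\<And>a. a \<in> set as \<Longrightarrow> cmod a \<le> 1"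
  shows "energy K (blaschke as * F) \<le> energy K F"
proof -
  have "energy K (lin_prod as * (inverse (rev_prod as) * F)) \<le> energy K (rev_prod as * (inverse (rev_prod as) * F))"
    using energy_lin_prod_le[OF assms] .
  then show ?thesis
    by (simp add: blaschke_def mult.assoc[symmetric] rev_prod_inverse)
qed

lemma cmod_nth_le_energy: "(cmod (fps_nth F k))\<^sup>2 \<le> energy k F"
  unfolding energy_def by (rule member_le_sum) auto

lemma energy_1: "energy K 1 = 1"
  by (induction K) (auto simp: energy_def)

lemma cmod_blaschke_nth_le:
  assumes "\<And>a. a \<in> set as \<Longrightarrow> cmod a \<le> 1"
  shows "cmod (fps_nth (blaschke as) k) \<le> 1"
proof -
  have "(cmod (fps_nth (blaschke as) k))\<^sup>2 \<le> energy k (blaschke as * 1)"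
    using cmod_nth_le_energy[of "blaschke as" k] by simp
  also have "\<dots> \<le> 1" using energy_blaschke_le[OF assms, of as k 1] by (simp only: energy_1)
  finally show ?thesis by (simp add: abs_square_le_1)
qed

text \<open>The coefficients of \<open>(F(X) - F(t)) / (X - t)\<close>.\<close>

definition diff_quot :: "real \<Rightarrow> complex fps \<Rightarrow> complex fps" where
  "diff_quot t F = Abs_fps (\<lambda>k. \<Sum>j. fps_nth F (j + Suc k) * complex_of_real t ^ j)"

context
  fixes as :: "complex list" and t :: real
  assumes as: "\<And>a. a \<in> set as \<Longrightarrow> cmod a \<le> 1" and t: "0 < t" "t < 1"
begin

lemma summable_blaschke: "summable (\<lambda>j. fps_nth (blaschke as) (j + m) * complex_of_real t ^ j)"
proof (rule summable_comparison_test')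
  show "summable (\<lambda>j. t ^ j)" using t by simp
  show "norm (fps_nth (blaschke as) (j + m) * complex_of_real t ^ j) \<le> t ^ j" if "j \<ge> 0" for j
    using cmod_blaschke_nth_le[of as "j + m", OF as] t by (simp add: norm_mult norm_power mult_left_le_one_le)
qed

lemma diff_quot_blaschke:
  "(fps_X - fps_const (complex_of_real t)) * diff_quot t (blaschke as)
     = blaschke as - fps_const (eval_fps (blaschke as) (complex_of_real t))"
proof (rule fps_ext)
  fix k
  let ?B = "blaschke as" and ?t = "complex_of_real t"
  have split: "(\<Sum>j. fps_nth ?B (j + m) * ?t ^ j) = fps_nth ?B m + ?t * (\<Sum>j. fps_nth ?B (j + Suc m) * ?t ^ j)" for m
    using suminf_split_head[OF summable_blaschke[of m]] suminf_mult[OF summable_blaschke[of "Suc m"], of ?t]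
    by (simp add: mult_ac add_eq_0_iff diff_eq_eq)
  show "fps_nth ((fps_X - fps_const ?t) * diff_quot t ?B) k = fps_nth (?B - fps_const (eval_fps ?B ?t)) k"
  proof (cases k)
    case 0
    then show ?thesis
      using split[of 0] by (simp add: linear_factor_nth diff_quot_def eval_fps_def)
  next
    case (Suc m)
    then show ?thesis
      using split[of "Suc m"] by (simp add: linear_factor_nth(2) diff_quot_def)
  qed
qed

text \<open>The truncation \<open>\<Sum>j<M. B\<^sub>j\<^sub>+\<^sub>k\<^sub>+\<^sub>1 t^j\<close> of the \<open>k\<close>-th coefficient is the coefficient of
  \<open>X^(M + k)\<close> in \<open>B * (\<Sum>i<M. t^(M - 1 - i) X^i)\<close>. Multiplication by \<open>B\<close> does not increase the energy,
  and the second factor has energy at most \<open>\<Sum>i. t^(2 i)\<close>. In terms of boundary values, \<open>B\<close> is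
  unimodular and \<open>(B - B(t)) / (z - t)\<close> is the analytic part of \<open>B / (z - t)\<close>.\<close>

lemma energy_diff_quot_le: "energy K (diff_quot t (blaschke as)) \<le> 1 / (1 - t\<^sup>2)"
proof -
  let ?B = "blaschke as" and ?t = "complex_of_real t"
  define part where "part M k = (\<Sum>j<M. fps_nth ?B (j + Suc k) * ?t ^ j)" for M k
  have "(\<Sum>k\<le>K. (cmod (part M k))\<^sup>2) \<le> 1 / (1 - t\<^sup>2)" for M
  proof -
    define G where "G = Abs_fps (\<lambda>i. if i < M then ?t ^ (M - Suc i) else 0)"
    have shift: "part M k = fps_nth (?B * G) (M + k)" for k
    proof -
      have "fps_nth (?B * G) (M + k) = (\<Sum>i=0..M + k. fps_nth G i * fps_nth ?B (M + k - i))"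
        by (subst mult.commute) (simp add: fps_mult_nth)
      also have "\<dots> = (\<Sum>i<M. fps_nth G i * fps_nth ?B (M + k - i))"
        by (rule sum.mono_neutral_right) (auto simp: G_def)
      also have "\<dots> = (\<Sum>i<M. ?t ^ (M - Suc i) * fps_nth ?B (Suc k + (M - Suc i)))"
        by (rule sum.cong) (auto simp: G_def intro!: arg_cong[where f = "fps_nth _"])
      also have "\<dots> = (\<Sum>j<M. ?t ^ j * fps_nth ?B (Suc k + j))"
        by (rule sum.nat_diff_reindex)
      finally show ?thesis by (simp add: part_def mult_ac add_ac)
    qed
    have "(\<Sum>k\<le>K. (cmod (part M k))\<^sup>2) = (\<Sum>k\<in>{M..M + K}. (cmod (fps_nth (?B * G) k))\<^sup>2)"
      unfolding shift by (rule sum.reindex_bij_witness[of _ "\<lambda>k. k - M" "\<lambda>k. M + k"]) auto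
    also have "\<dots> \<le> energy (M + K) (?B * G)"
      unfolding energy_def by (rule sum_mono2) auto
    also have "\<dots> \<le> energy (M + K) G" by (rule energy_blaschke_le[OF as])
    also have "\<dots> = (\<Sum>i<M. (cmod (fps_nth G i))\<^sup>2)"
      unfolding energy_def by (rule sum.mono_neutral_right) (auto simp: G_def)
    also have "\<dots> = (\<Sum>i<M. (t\<^sup>2) ^ (M - Suc i))"
      using t by (intro sum.cong) (auto simp: G_def norm_power power_mult[symmetric] mult.commute)
    also have "\<dots> = (\<Sum>i<M. (t\<^sup>2) ^ i)" by (rule sum.nat_diff_reindex)
    also have "\<dots> \<le> (\<Sum>i. (t\<^sup>2) ^ i)"
      using t by (intro sum_le_suminf summable_geometric) (auto simp: abs_square_less_1 power_less_one_iff)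
    also have "\<dots> = 1 / (1 - t\<^sup>2)"
      using t by (intro suminf_geometric) (auto simp: power_less_one_iff)
    finally show ?thesis .
  qed
  moreover have "(\<lambda>M. \<Sum>k\<le>K. (cmod (part M k))\<^sup>2) \<longlonglongrightarrow> energy K (diff_quot t ?B)"
    unfolding energy_def diff_quot_def part_def fps_nth_Abs_fps
    by (intro tendsto_intros summable_LIMSEQ summable_blaschke)
  ultimately show ?thesis by (intro LIMSEQ_le_const2) auto
qed

lemma sum_cmod_diff_quot_le:
  "(\<Sum>k<K. cmod (fps_nth (diff_quot t (blaschke as)) k) * t ^ k) \<le> 1 / (1 - t\<^sup>2)"
proof -
  let ?h = "\<lambda>k. cmod (fps_nth (diff_quot t (blaschke as)) k)"
  have t2: "0 < 1 - t\<^sup>2" using t by (simp add: power_less_one_iff)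
  have "(\<Sum>k<K. ?h k * t ^ k)\<^sup>2 \<le> (\<Sum>k<K. (?h k)\<^sup>2) * (\<Sum>k<K. (t ^ k)\<^sup>2)"
    by (rule Cauchy_Schwarz_ineq_sum)
  also have "\<dots> \<le> (1 / (1 - t\<^sup>2)) * (1 / (1 - t\<^sup>2))"
  proof (intro mult_mono)
    have "(\<Sum>k<K. (?h k)\<^sup>2) \<le> energy K (diff_quot t (blaschke as))"
      unfolding energy_def by (rule sum_mono2) auto
    then show "(\<Sum>k<K. (?h k)\<^sup>2) \<le> 1 / (1 - t\<^sup>2)" using energy_diff_quot_le[of K] by linarith
    have "(\<Sum>k<K. (t ^ k)\<^sup>2) = (\<Sum>k<K. (t\<^sup>2) ^ k)" by (simp add: power_mult[symmetric] mult.commute)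
    also have "\<dots> \<le> (\<Sum>k. (t\<^sup>2) ^ k)"
      using t by (intro sum_le_suminf summable_geometric) (auto simp: power_less_one_iff)
    also have "\<dots> = 1 / (1 - t\<^sup>2)"
      using t by (intro suminf_geometric) (auto simp: power_less_one_iff)
    finally show "(\<Sum>k<K. (t ^ k)\<^sup>2) \<le> 1 / (1 - t\<^sup>2)" .
  qed (use t2 in \<open>auto intro: sum_nonneg\<close>)
  finally have "(\<Sum>k<K. ?h k * t ^ k)\<^sup>2 \<le> (1 / (1 - t\<^sup>2))\<^sup>2" by (simp add: power2_eq_square)
  then show ?thesis by (rule power2_le_imp_le) (use t2 in simp)
qed

lemma bounded_diff_quot: "\<exists>C. \<forall>k. cmod (fps_nth (diff_quot t (blaschke as)) k) \<le> C"
proof (intro exI allI)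
  fix k
  show "cmod (fps_nth (diff_quot t (blaschke as)) k) \<le> sqrt (1 / (1 - t\<^sup>2))"
    using cmod_nth_le_energy[of "diff_quot t (blaschke as)" k] energy_diff_quot_le[of k]
    by (intro real_le_rsqrt) linarith
qed

lemma eval_blaschke:
  "eval_fps (blaschke as) (complex_of_real t) * (\<Prod>a\<leftarrow>as. 1 - cnj a * complex_of_real t)
     = (\<Prod>a\<leftarrow>as. complex_of_real t - a)"
proof -
  let ?t = "complex_of_real t"
  have conv: "fps_conv_radius (rev_prod bs) = \<infinity>" "fps_conv_radius (lin_prod bs) = \<infinity>" for bs
  proof -
    have mult: "fps_conv_radius (F * G) = \<infinity>" if "fps_conv_radius F = \<infinity>" "fps_conv_radius G = \<infinity>"
      for F G :: "complex fps"
      using fps_conv_radius_mult[of F G] that by simp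
    have diff: "fps_conv_radius (F - G) = \<infinity>" if "fps_conv_radius F = \<infinity>" "fps_conv_radius G = \<infinity>"
      for F G :: "complex fps"
      using fps_conv_radius_diff[of F G] that by simp
    show "fps_conv_radius (rev_prod bs) = \<infinity>" "fps_conv_radius (lin_prod bs) = \<infinity>"
      by (induction bs) (auto simp: rev_prod_def lin_prod_def intro!: mult diff)
  qed
  have lin: "eval_fps (lin_prod bs) ?t = (\<Prod>a\<leftarrow>bs. ?t - a)" for bs
  proof (induction bs)
    case (Cons b bs)
    have "lin_prod (b # bs) = lin_prod [b] * lin_prod bs" by (simp add: lin_prod_def)
    moreover have "eval_fps (lin_prod [b]) ?t = ?t - b"
      by (simp add: lin_prod_def eval_fps_diff)
    ultimately show ?case using Cons by (simp add: eval_fps_mult conv)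
  qed (simp add: lin_prod_def)
  have rev: "eval_fps (rev_prod bs) ?t = (\<Prod>a\<leftarrow>bs. 1 - cnj a * ?t)" for bs
  proof (induction bs)
    case (Cons b bs)
    have "rev_prod (b # bs) = rev_prod [b] * rev_prod bs" by (simp add: rev_prod_def)
    moreover have "eval_fps (rev_prod [b]) ?t = 1 - cnj b * ?t"
      using conv(1)[of "[b]"] fps_conv_radius_mult[of "fps_const (cnj b)" fps_X]
      by (simp add: rev_prod_def eval_fps_diff eval_fps_mult)
    ultimately show ?case using Cons by (simp add: eval_fps_mult conv)
  qed (simp add: rev_prod_def)
  \<comment> \<open>The coefficients are bounded by \<open>1\<close>, so the series converges at any \<open>r\<close> between \<open>t\<close> and \<open>1\<close>.\<close>
  obtain r where r: "t < r" "r < 1" using dense[OF t(2)] by blast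
  have "summable (\<lambda>n. fps_nth (blaschke as) n * complex_of_real r ^ n)"
  proof (rule summable_comparison_test')
    show "summable (\<lambda>j. r ^ j)" using t r by simp
    show "norm (fps_nth (blaschke as) j * complex_of_real r ^ j) \<le> r ^ j" if "j \<ge> 0" for j
      using cmod_blaschke_nth_le[of as j, OF as] t r by (simp add: norm_mult norm_power mult_left_le_one_le)
  qed
  then have "ereal (norm (complex_of_real r)) \<le> fps_conv_radius (blaschke as)"
    unfolding fps_conv_radius_def by (rule conv_radius_geI)
  moreover have "ereal (norm ?t) < ereal (norm (complex_of_real r))"
    using t r by simp
  ultimately have "ereal (norm ?t) < fps_conv_radius (blaschke as)"
    by (rule less_le_trans[rotated])
  then have "eval_fps (blaschke as * rev_prod as) ?t = eval_fps (blaschke as) ?t * eval_fps (rev_prod as) ?t"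
    by (intro eval_fps_mult) (auto simp: conv)
  then show ?thesis by (simp add: blaschke_mult_rev_prod lin rev)
qed

end

definition bounded_coeffs :: "complex fps \<Rightarrow> bool" where
  "bounded_coeffs F \<longleftrightarrow> (\<exists>C. \<forall>k. cmod (fps_nth F k) \<le> C)"

lemma bounded_coeffs_linear_factor:
  assumes "bounded_coeffs F"
  shows "bounded_coeffs ((fps_X - fps_const a) * F)"
proof -
  obtain C where C: "\<And>k. cmod (fps_nth F k) \<le> C" using assms by (auto simp: bounded_coeffs_def)
  have C0: "C \<ge> 0" using C[of 0] norm_ge_zero order_trans by blast
  have aC: "cmod (a * fps_nth F k) \<le> cmod a * C" for k
    using C[of k] by (simp add: norm_mult mult_left_mono)
  have "cmod (fps_nth ((fps_X - fps_const a) * F) k) \<le> C + cmod a * C" for k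
  proof (cases k)
    case 0
    then show ?thesis using aC[of 0] C0 by (simp only: linear_factor_nth) simp
  next
    case (Suc m)
    then show ?thesis
      using norm_triangle_ineq4[of "fps_nth F m" "a * fps_nth F (Suc m)"] C[of m] aC[of "Suc m"]
      by (simp only: linear_factor_nth)
  qed
  then show ?thesis unfolding bounded_coeffs_def by blast
qed

text \<open>With \<open>G = (1 - a X) F\<close>, the coefficients satisfy the recursion \<open>F\<^sub>k\<^sub>+\<^sub>1 = G\<^sub>k\<^sub>+\<^sub>1 + a F\<^sub>k\<close>, which is a contraction.\<close>

lemma bounded_coeffs_solve:
  assumes "bounded_coeffs ((1 - fps_const a * fps_X) * F)" "cmod a < 1"
  shows "bounded_coeffs F"
proof -
  obtain C where C: "\<And>k. cmod (fps_nth ((1 - fps_const a * fps_X) * F) k) \<le> C"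
    using assms(1) by (auto simp: bounded_coeffs_def)
  have C0: "C \<ge> 0" using C[of 0] norm_ge_zero order_trans by blast
  have "cmod (fps_nth F k) \<le> C / (1 - cmod a)" for k
  proof (induction k)
    case 0
    have "C \<le> C / (1 - cmod a)" using C0 assms(2) by (simp add: le_divide_eq mult_left_le)
    then show ?case using C[of 0] by (simp only: linear_factor_nth)
  next
    case (Suc k)
    have "fps_nth F (Suc k) = fps_nth ((1 - fps_const a * fps_X) * F) (Suc k) + a * fps_nth F k"
      by (simp only: linear_factor_nth diff_add_cancel)
    then have "cmod (fps_nth F (Suc k)) \<le> C + cmod a * cmod (fps_nth F k)"
      by (metis C add_mono_thms_linordered_semiring(3) norm_mult norm_triangle_le add_right_mono)
    also have "\<dots> \<le> C + cmod a * (C / (1 - cmod a))"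
      using Suc by (intro add_left_mono mult_left_mono) auto
    also have "\<dots> = C / (1 - cmod a)" using assms(2) by (simp add: field_simps)
    finally show ?case .
  qed
  then show ?thesis unfolding bounded_coeffs_def by blast
qed

lemma bounded_coeffs_inverse_rev_prod:
  assumes "\<And>a. a \<in> set as \<Longrightarrow> cmod a < 1"
  shows "bounded_coeffs (inverse (rev_prod as))"
  using assms
proof (induction as)
  case Nil
  have "cmod (fps_nth 1 k) \<le> 1" for k by simp
  then show ?case by (auto simp: rev_prod_def bounded_coeffs_def intro!: exI[of _ 1])
next
  case (Cons a as)
  have cancel: "x * i = j" if "z = x * y" "z * i = 1" "y * j = 1" for x y z i j :: "complex fps"
  proof -
    have "x * i = (x * i) * (y * j)" by (simp only: that(3) mult_1_right)
    also have "\<dots> = (x * y * i) * j" by (simp only: mult_ac)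
    finally show ?thesis by (simp only: that(1)[symmetric] that(2) mult_1_left)
  qed
  have eq: "(1 - fps_const (cnj a) * fps_X) * inverse (rev_prod (a # as)) = inverse (rev_prod as)"
    by (rule cancel[OF _ rev_prod_inverse rev_prod_inverse]) (simp add: rev_prod_def)
  have "bounded_coeffs (inverse (rev_prod as))" by (rule Cons.IH) (rule Cons.prems, simp)
  then have "bounded_coeffs ((1 - fps_const (cnj a) * fps_X) * inverse (rev_prod (a # as)))"
    by (simp only: eq)
  then show ?case
    by (rule bounded_coeffs_solve) (use Cons.prems[of a] in simp)
qed

section \<open>Power series in a positive trace-preserving map\<close>

lemma bounded_linear_mscale: "bounded_linear (\<lambda>X. c *\<^sub>M (X :: 'n::finite cmat))"
  unfolding linear_conv_bounded_linear[symmetric]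
  by (intro linearI) (simp_all add: mscale.scale_right_distrib scaleR_eq_mscale mult.commute)

lemma norm_sums_le:
  fixes c :: "nat \<Rightarrow> 'a::real_normed_vector"
  assumes "c sums S" "\<And>K. (\<Sum>k<K. norm (c k)) \<le> M"
  shows "norm S \<le> M"
proof (rule LIMSEQ_le_const2)
  show "(\<lambda>K. norm (\<Sum>k<K. c k)) \<longlonglongrightarrow> norm S"
    using assms(1) by (intro tendsto_norm) (simp add: sums_def)
  show "\<exists>N. \<forall>K\<ge>N. norm (\<Sum>k<K. c k) \<le> M"
    using assms(2) order_trans[OF norm_sum] by blast
qed

context positive_tp_map
begin

text \<open>\<open>F(t T) v = x\<close>, as a relation because the series need not converge. The case \<open>t = 1\<close> serves
  for polynomials; for \<open>\<bar>t\<bar> < 1\<close> bounded coefficients suffice.\<close>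

definition eval_sums :: "complex \<Rightarrow> complex fps \<Rightarrow> 'n cmat \<Rightarrow> 'n cmat \<Rightarrow> bool" where
  "eval_sums t F v x \<longleftrightarrow> (\<lambda>k. (fps_nth F k * t ^ k) *\<^sub>M (T ^^ k) v) sums x"

lemma eval_sums_diff: "eval_sums t F u x \<Longrightarrow> eval_sums t F v y \<Longrightarrow> eval_sums t F (u - v) (x - y)"
  unfolding eval_sums_def using sums_diff by (simp add: pow_simps mscale.scale_right_diff_distrib)

lemma eval_sums_fps_diff: "eval_sums t F v x \<Longrightarrow> eval_sums t G v y \<Longrightarrow> eval_sums t (F - G) v (x - y)"
  unfolding eval_sums_def using sums_diff
  by (fastforce simp: left_diff_distrib mscale.scale_left_diff_distrib)

lemma eval_sums_mscale:
  assumes "eval_sums t F v x"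
  shows "eval_sums t F (c *\<^sub>M v) (c *\<^sub>M x)"
  using bounded_linear.sums[OF bounded_linear_mscale assms[unfolded eval_sums_def], of c]
  by (simp add: eval_sums_def pow_simps mult_ac)

lemma eval_sums_unique: "eval_sums t F v x \<Longrightarrow> eval_sums t F v y \<Longrightarrow> x = y"
  unfolding eval_sums_def by (rule sums_unique2)

lemma eval_sums_const: "eval_sums t (fps_const c) v (c *\<^sub>M v)"
proof -
  have "(\<lambda>k. (fps_nth (fps_const c) k * t ^ k) *\<^sub>M (T ^^ k) v) = (\<lambda>k. if k = 0 then c *\<^sub>M v else 0)"
    by auto
  then show ?thesis unfolding eval_sums_def using sums_single[of 0 "\<lambda>_. c *\<^sub>M v"] by simp
qed

lemma eval_sums_linear_factor:
  assumes x: "eval_sums t F (t *\<^sub>M T v) x" and y: "eval_sums t F v y"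
  shows "eval_sums t ((fps_X - fps_const a) * F) v (x - a *\<^sub>M y)"
proof -
  have "eval_sums t (fps_X * F) v x"
  proof -
    let ?g = "\<lambda>k. (fps_nth (fps_X * F) k * t ^ k) *\<^sub>M (T ^^ k) v"
    have "(\<lambda>k. ?g (Suc k)) sums x"
      using x unfolding eval_sums_def by (simp add: pow_simps funpow_swap1 mult_ac)
    then have "?g sums (x + ?g 0)" by (rule sums_Suc)
    then show ?thesis by (simp add: eval_sums_def)
  qed
  moreover have "eval_sums t (fps_const a * F) v (a *\<^sub>M y)"
    using bounded_linear.sums[OF bounded_linear_mscale y[unfolded eval_sums_def], of a]
    by (simp add: eval_sums_def mult.assoc)
  ultimately show ?thesis unfolding left_diff_distrib by (rule eval_sums_fps_diff)
qed

lemma eval_sums_exists: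
  assumes "bounded_coeffs F" "cmod t < 1"
  shows "\<exists>x. eval_sums t F v x"
proof -
  obtain C where C: "\<And>k. cmod (fps_nth F k) \<le> C" using assms(1) by (auto simp: bounded_coeffs_def)
  obtain D where D: "\<And>k. norm ((T ^^ k) v) \<le> D" using power_bounded by blast
  have C0: "C \<ge> 0" using order_trans[OF norm_ge_zero C[of 0]] .
  have "summable (\<lambda>k. (fps_nth F k * t ^ k) *\<^sub>M (T ^^ k) v)"
  proof (rule summable_comparison_test')
    show "summable (\<lambda>k. C * D * cmod t ^ k)"
      using assms(2) by (intro summable_mult summable_geometric) simp
    show "norm ((fps_nth F k * t ^ k) *\<^sub>M (T ^^ k) v) \<le> C * D * cmod t ^ k" if "k \<ge> 0" for k
    proof -
      have "cmod (fps_nth F k) * norm ((T ^^ k) v) \<le> C * D"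
        using C[of k] D[of k] C0 by (intro mult_mono) auto
      then have "cmod (fps_nth F k) * norm ((T ^^ k) v) * cmod t ^ k \<le> C * D * cmod t ^ k"
        by (rule mult_right_mono) simp
      then show ?thesis by (simp only: norm_mscale norm_mult norm_power mult_ac)
    qed
  qed
  then show ?thesis unfolding eval_sums_def summable_def .
qed

definition apply_roots :: "complex list \<Rightarrow> 'n cmat \<Rightarrow> 'n cmat" where
  "apply_roots ls v = fold (\<lambda>l v. T v - l *\<^sub>M v) ls v"

lemma apply_roots_mscale: "apply_roots ls (c *\<^sub>M v) = c *\<^sub>M apply_roots ls v"
proof (induction ls arbitrary: v)
  case (Cons l ls)
  have "T (c *\<^sub>M v) - l *\<^sub>M c *\<^sub>M v = c *\<^sub>M (T v - l *\<^sub>M v)"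
    by (simp add: T_simps mscale.scale_right_diff_distrib mult.commute)
  then show ?case using Cons by (simp add: apply_roots_def)
qed (simp add: apply_roots_def)

lemma bounded_coeffs_lin_prod: "bounded_coeffs F \<Longrightarrow> bounded_coeffs (lin_prod as * F)"
  by (induction as) (simp_all add: lin_prod_def mult.assoc bounded_coeffs_linear_factor)

text \<open>The zeros are scaled by \<open>t\<close> because \<open>t T - t l = t (T - l)\<close>.\<close>

lemma eval_sums_lin_prod_eq_0:
  assumes F: "bounded_coeffs F" and t: "cmod t < 1" and "apply_roots ls v = 0"
  shows "eval_sums t (lin_prod (map ((*) t) ls) * F) v 0"
  using assms(3)
proof (induction ls arbitrary: v)
  case Nil
  then show ?case by (simp add: apply_roots_def eval_sums_def pow_simps)
next
  case (Cons l ls)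
  let ?G = "lin_prod (map ((*) t) ls) * F"
  obtain x y where x: "eval_sums t ?G (t *\<^sub>M T v) x" and y: "eval_sums t ?G v y"
    using eval_sums_exists[OF bounded_coeffs_lin_prod[OF F] t] by blast
  have "apply_roots ls (t *\<^sub>M (T v - l *\<^sub>M v)) = 0"
    using Cons.prems by (simp add: apply_roots_mscale) (simp add: apply_roots_def)
  from Cons.IH[OF this] have "eval_sums t ?G (t *\<^sub>M T v - (t * l) *\<^sub>M v) 0"
    by (simp add: mscale.scale_right_diff_distrib)
  moreover have "eval_sums t ?G (t *\<^sub>M T v - (t * l) *\<^sub>M v) (x - (t * l) *\<^sub>M y)"
    by (intro eval_sums_diff eval_sums_mscale x y)
  ultimately have "x - (t * l) *\<^sub>M y = 0" using eval_sums_unique by blast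
  then have "eval_sums t ((fps_X - fps_const (t * l)) * ?G) v 0"
    using eval_sums_linear_factor[OF x y, of "t * l"] by (simp only:)
  then show ?case by (simp add: lin_prod_def mult.assoc)
qed

text \<open>Since \<open>B(t T) w = 0\<close>, the quotient \<open>h = (B - B(t)) / (X - t)\<close> satisfies
  \<open>h(t T) (t T - t) w = - B(t) w\<close>: it inverts \<open>1 - T\<close> at \<open>w\<close>, up to the scalar \<open>B(t) / t\<close>.\<close>

lemma resolvent_series:
  fixes t :: real
  assumes t: "0 < t" "t < 1" and ls: "\<And>l. l \<in> set ls \<Longrightarrow> cmod l \<le> 1" and w: "apply_roots ls w = 0"
  defines "B \<equiv> blaschke (map ((*) (complex_of_real t)) ls)"
  shows "eval_sums t (diff_quot t B) (w - T w) ((eval_fps B t / t) *\<^sub>M w)"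
proof -
  let ?t = "complex_of_real t"
  define as where "as = map ((*) ?t) ls"
  have lt1: "cmod a < 1" if a: "a \<in> set as" for a
  proof -
    obtain l where l: "l \<in> set ls" "a = ?t * l" using a by (auto simp: as_def)
    have "cmod a = t * cmod l" using l(2) t by (simp add: norm_mult)
    also have "\<dots> \<le> t * 1" using ls[OF l(1)] t by (intro mult_left_mono) auto
    finally show ?thesis using t by simp
  qed
  then have le1: "\<And>a. a \<in> set as \<Longrightarrow> cmod a \<le> 1" by (simp add: less_imp_le)
  have ct: "cmod ?t < 1" using t by simp
  have B: "B = blaschke as" by (simp add: B_def as_def)
  have "eval_sums ?t B w 0"
    unfolding B blaschke_def unfolding as_def
    by (intro eval_sums_lin_prod_eq_0 ct w bounded_coeffs_inverse_rev_prod) (use lt1 as_def in blast)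
  then have "eval_sums ?t (B - fps_const (eval_fps B ?t)) w (0 - eval_fps B ?t *\<^sub>M w)"
    by (intro eval_sums_fps_diff eval_sums_const)
  then have 1: "eval_sums ?t ((fps_X - fps_const ?t) * diff_quot t B) w (- (eval_fps B ?t *\<^sub>M w))"
    by (simp only: B diff_quot_blaschke[of as t, OF le1 t] diff_0)
  have "bounded_coeffs (diff_quot t B)"
    unfolding B bounded_coeffs_def by (rule bounded_diff_quot[of as t, OF le1 t])
  then obtain x y where x: "eval_sums ?t (diff_quot t B) (?t *\<^sub>M T w) x" and y: "eval_sums ?t (diff_quot t B) w y"
    using eval_sums_exists ct by blast
  have "x - ?t *\<^sub>M y = - (eval_fps B ?t *\<^sub>M w)"
    using eval_sums_unique[OF eval_sums_linear_factor[OF x y] 1] .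
  moreover have "eval_sums ?t (diff_quot t B) (?t *\<^sub>M T w - ?t *\<^sub>M w) (x - ?t *\<^sub>M y)"
    by (intro eval_sums_diff eval_sums_mscale x y)
  ultimately have "eval_sums ?t (diff_quot t B) (?t *\<^sub>M T w - ?t *\<^sub>M w) (- (eval_fps B ?t *\<^sub>M w))"
    by (simp only:)
  from eval_sums_mscale[OF this, of "- 1 / ?t"] show ?thesis
    using t by (simp add: mscale.scale_right_diff_distrib)
qed

text \<open>Testing the series of the previous lemma against a form that attains \<open>\<parallel>w\<parallel>\<^sub>1\<close>, each term
  contributes at most \<open>\<bar>h\<^sub>k\<bar> t^k \<parallel>w - T w\<parallel>\<^sub>1\<close> because the powers of \<open>T\<close> are contractions on
  Hermitian matrices. The coefficients \<open>h\<^sub>k\<close> may be complex although \<open>w\<close> is Hermitian.\<close>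

lemma resolvent_trace_norm_le:
  fixes t :: real
  assumes t: "0 < t" "t < 1" and ls: "\<And>l. l \<in> set ls \<Longrightarrow> cmod l \<le> 1" and w: "apply_roots ls w = 0"
    and herm: "dagger w = w"
  defines "B \<equiv> blaschke (map ((*) (complex_of_real t)) ls)"
  shows "cmod (eval_fps B t) / t * trace_norm w \<le> trace_norm (w - T w) / (1 - t\<^sup>2)"
proof -
  let ?t = "complex_of_real t" and ?\<sigma> = "w - T w"
  have herm\<sigma>: "dagger ?\<sigma> = ?\<sigma>" by (simp add: dagger_simps herm hermitian_T)
  obtain v s where v: "onb v" "\<And>i. \<bar>s i\<bar> \<le> 1" and tn: "trace_norm w = Re (dual_form v s w)"
    using trace_norm_attained[OF herm] by blast
  have series: "(\<lambda>k. (fps_nth (diff_quot t B) k * ?t ^ k) * dual_form v s ((T ^^ k) ?\<sigma>))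
      sums (eval_fps B ?t / ?t * dual_form v s w)"
    using bounded_linear.sums[OF bounded_linear_dual_form[of v s] resolvent_series[OF t ls w, unfolded eval_sums_def]]
    by (simp add: dual_form_mscale B_def)
  have tn\<sigma>: "0 \<le> trace_norm ?\<sigma>"
    using hermitian_entry_le_trace_norm[OF herm\<sigma>] order_trans[OF norm_ge_zero] by blast
  have "cmod (eval_fps B ?t / ?t * dual_form v s w) \<le> 1 / (1 - t\<^sup>2) * trace_norm ?\<sigma>"
  proof (rule norm_sums_le[OF series])
    fix K
    have "(\<Sum>k<K. cmod (fps_nth (diff_quot t B) k * ?t ^ k * dual_form v s ((T ^^ k) ?\<sigma>)))
        \<le> (\<Sum>k<K. cmod (fps_nth (diff_quot t B) k) * t ^ k * trace_norm ?\<sigma>)"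
    proof (rule sum_mono)
      fix k
      have "cmod (dual_form v s ((T ^^ k) ?\<sigma>)) \<le> trace_norm ?\<sigma>"
        using dual_form_le_trace_norm[OF v hermitian_pow[OF herm\<sigma>]] trace_norm_pow_le[OF herm\<sigma>]
        by (rule order_trans)
      then show "cmod (fps_nth (diff_quot t B) k * ?t ^ k * dual_form v s ((T ^^ k) ?\<sigma>))
          \<le> cmod (fps_nth (diff_quot t B) k) * t ^ k * trace_norm ?\<sigma>"
        using t by (simp add: norm_mult norm_power mult_left_mono)
    qed
    also have "\<dots> = (\<Sum>k<K. cmod (fps_nth (diff_quot t B) k) * t ^ k) * trace_norm ?\<sigma>"
      by (simp add: sum_distrib_right)
    also have "\<dots> \<le> 1 / (1 - t\<^sup>2) * trace_norm ?\<sigma>"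
    proof (rule mult_right_mono[OF _ tn\<sigma>])
      have "cmod a \<le> 1" if a: "a \<in> set (map ((*) ?t) ls)" for a
      proof -
        obtain l where "l \<in> set ls" "a = ?t * l" using a by auto
        then show ?thesis using ls[of l] t by (simp add: norm_mult mult_le_one)
      qed
      then show "(\<Sum>k<K. cmod (fps_nth (diff_quot t B) k) * t ^ k) \<le> 1 / (1 - t\<^sup>2)"
        unfolding B_def by (rule sum_cmod_diff_quot_le[OF _ t])
    qed
    finally show "(\<Sum>k<K. cmod (fps_nth (diff_quot t B) k * ?t ^ k * dual_form v s ((T ^^ k) ?\<sigma>)))
        \<le> 1 / (1 - t\<^sup>2) * trace_norm ?\<sigma>" .
  qed
  moreover have "cmod (eval_fps B ?t) / t * trace_norm w \<le> cmod (eval_fps B ?t / ?t * dual_form v s w)"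
    unfolding tn using t complex_Re_le_cmod[of "dual_form v s w"]
    by (simp add: norm_mult norm_divide mult_left_mono divide_right_mono)
  ultimately show ?thesis by simp
qed

section \<open>Annihilating polynomials and eigenvalues on traceless matrices\<close>

definition poly_op :: "complex poly \<Rightarrow> 'n cmat \<Rightarrow> 'n cmat" where
  "poly_op p v = (\<Sum>i\<le>degree p. coeff p i *\<^sub>M (T ^^ i) v)"

lemma eval_sums_poly: "eval_sums 1 (fps_of_poly p) v (poly_op p v)"
  unfolding eval_sums_def poly_op_def
  by (rule sums_cong[THEN iffD1, OF _ sums_finite[of "{..degree p}" "\<lambda>i. coeff p i *\<^sub>M (T ^^ i) v"]])
    (auto simp: coeff_eq_0)

lemma poly_op_linear_factor: "poly_op ([:- a, 1:] * q) v = poly_op q (T v) - a *\<^sub>M poly_op q v"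
proof -
  have "fps_of_poly ([:- a, 1:] * q) = (fps_X - fps_const a) * fps_of_poly q"
    by (simp add: fps_of_poly_mult fps_of_poly_pCons)
  moreover have "eval_sums 1 ((fps_X - fps_const a) * fps_of_poly q) v (poly_op q (T v) - a *\<^sub>M poly_op q v)"
    using eval_sums_poly[of q "T v"] by (intro eval_sums_linear_factor eval_sums_poly) simp
  ultimately show ?thesis
    using eval_sums_poly[of "[:- a, 1:] * q" v] eval_sums_unique by (simp only:)
qed

lemma poly_op_simps:
  "poly_op p (u - v) = poly_op p u - poly_op p v" "poly_op p (c *\<^sub>M v) = c *\<^sub>M poly_op p v"
  "poly_op p (T v) = T (poly_op p v)"
proof -
  show "poly_op p (u - v) = poly_op p u - poly_op p v"
    by (simp add: poly_op_def pow_simps mscale.scale_right_diff_distrib sum_subtractf)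
  show "poly_op p (c *\<^sub>M v) = c *\<^sub>M poly_op p v"
    by (simp add: poly_op_def pow_simps mscale.scale_sum_right mult.commute)
  show "poly_op p (T v) = T (poly_op p v)"
    by (simp add: poly_op_def T.sum T_simps funpow_swap1)
qed

lemma trace_poly_op: "trace v = 0 \<Longrightarrow> trace (poly_op p v) = 0"
proof -
  assume v: "trace v = 0"
  have "trace (\<Sum>i\<in>I. coeff p i *\<^sub>M (T ^^ i) v) = (\<Sum>i\<in>I. coeff p i * trace v)" for I
    by (induction I rule: infinite_finite_induct) (simp_all add: trace_add trace_mscale trace_def[of 0])
  then show ?thesis by (simp add: poly_op_def v)
qed

text \<open>A linear dependence over the reals of \<open>v, T v, T\<^sup>2 v, \<dots>\<close>; the degree is therefore bounded by the
  real dimension \<open>2 n\<^sup>2\<close>.\<close>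

lemma annihilating_poly_exists:
  "\<exists>p. p \<noteq> 0 \<and> degree p \<le> DIM('n cmat) \<and> poly_op p v = 0"
proof -
  let ?N = "DIM('n cmat)"
  have "\<exists>c :: nat \<Rightarrow> real. (\<exists>i\<le>?N. c i \<noteq> 0) \<and> (\<Sum>i\<le>?N. c i *\<^sub>R (T ^^ i) v) = 0"
  proof (cases "inj_on (\<lambda>i. (T ^^ i) v) {..?N}")
    case True
    let ?S = "(\<lambda>i. (T ^^ i) v) ` {..?N}"
    have "card ?S = Suc ?N" using True by (simp add: card_image)
    then have "dependent ?S" by (intro dependent_biggerset) simp
    then obtain u where u: "\<exists>x\<in>?S. u x \<noteq> 0" "(\<Sum>x\<in>?S. u x *\<^sub>R x) = 0"
      by (auto simp: dependent_finite)
    have "(\<Sum>i\<le>?N. u ((T ^^ i) v) *\<^sub>R (T ^^ i) v) = 0"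
      using u(2) unfolding sum.reindex[OF True] o_def .
    then show ?thesis using u(1) by (intro exI[of _ "\<lambda>i. u ((T ^^ i) v)"]) auto
  next
    case False
    then obtain i j where ij: "i \<le> ?N" "j \<le> ?N" "i \<noteq> j" "(T ^^ i) v = (T ^^ j) v"
      by (auto simp: inj_on_def)
    define c :: "nat \<Rightarrow> real" where "c k = (if k = i then 1 else 0) - (if k = j then 1 else 0)" for k
    have "c k *\<^sub>R (T ^^ k) v = (if k = i then (T ^^ k) v else 0) - (if k = j then (T ^^ k) v else 0)" for k
      by (simp add: c_def)
    then have "(\<Sum>k\<le>?N. c k *\<^sub>R (T ^^ k) v)
        = (\<Sum>k\<le>?N. if k = i then (T ^^ k) v else 0) - (\<Sum>k\<le>?N. if k = j then (T ^^ k) v else 0)"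
      by (simp only: sum_subtractf)
    also have "\<dots> = 0" using ij by simp
    finally show ?thesis using ij by (intro exI[of _ c]) (auto simp: c_def)
  qed
  then obtain c :: "nat \<Rightarrow> real" where c: "\<exists>i\<le>?N. c i \<noteq> 0" "(\<Sum>i\<le>?N. c i *\<^sub>R (T ^^ i) v) = 0"
    by blast
  define p where "p = (\<Sum>i\<le>?N. monom (complex_of_real (c i)) i)"
  have coeff: "coeff p k = (if k \<le> ?N then complex_of_real (c k) else 0)" for k
    by (auto simp: p_def coeff_sum)
  have deg: "degree p \<le> ?N" by (rule degree_le) (simp add: coeff)
  have "poly_op p v = (\<Sum>i\<le>?N. coeff p i *\<^sub>M (T ^^ i) v)"
    unfolding poly_op_def using deg by (intro sum.mono_neutral_left) (auto simp: coeff_eq_0)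
  also have "\<dots> = 0" using c(2) by (simp add: coeff scaleR_eq_mscale)
  finally have "poly_op p v = 0" .
  moreover have "p \<noteq> 0" using c(1) coeff by (metis coeff_0 of_real_eq_0_iff)
  ultimately show ?thesis using deg by blast
qed

definition traceless_eigenvalues :: "complex set" where
  "traceless_eigenvalues = {l. \<exists>X. X \<noteq> 0 \<and> trace X = 0 \<and> T X = l *\<^sub>M X}"

text \<open>A root \<open>z\<close> of an annihilating polynomial \<open>(X - z) q\<close> that is no eigenvalue can be discarded:
  \<open>(T - z) (q(T) v) = 0\<close> forces \<open>q(T) v = 0\<close>.\<close>

lemma annihilating_roots:
  assumes "p \<noteq> 0" "poly_op p v = 0" "trace v = 0"
  shows "\<exists>ls. set ls \<subseteq> traceless_eigenvalues \<and> length ls \<le> degree p \<and> apply_roots ls v = 0"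
  using assms
proof (induction "degree p" arbitrary: p v)
  case 0
  have "coeff p 0 \<noteq> 0" using leading_coeff_0_iff[of p] 0(1,2) by metis
  moreover have "poly_op p v = coeff p 0 *\<^sub>M v" using 0(1) by (simp add: poly_op_def)
  ultimately have "v = 0" using 0(3) by simp
  then show ?case by (intro exI[of _ "[]"]) (simp add: apply_roots_def)
next
  case (Suc d)
  have "\<not> constant (poly p)" using Suc(2) by (simp add: constant_degree)
  then obtain z where "poly p z = 0" using fundamental_theorem_of_algebra by blast
  then obtain q where p: "p = [:- z, 1:] * q" by (auto simp: poly_eq_0_iff_dvd elim: dvdE)
  have q: "q \<noteq> 0" using p Suc.prems(1) by auto
  then have deg: "d = degree q" using Suc(2) unfolding p by (subst (asm) degree_mult_eq) auto
  show ?case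
  proof (cases "z \<in> traceless_eigenvalues")
    case True
    have "poly_op q (T v - z *\<^sub>M v) = 0"
      using Suc.prems(2) unfolding p poly_op_linear_factor by (simp add: poly_op_simps)
    moreover have "trace (T v - z *\<^sub>M v) = 0"
      using Suc.prems(3) by (simp add: trace_sub trace_mscale)
    ultimately obtain ls where "set ls \<subseteq> traceless_eigenvalues" "length ls \<le> degree q"
        "apply_roots ls (T v - z *\<^sub>M v) = 0"
      using Suc(1)[OF deg q] by blast
    then show ?thesis
      using True Suc(2) deg by (intro exI[of _ "z # ls"]) (auto simp: apply_roots_def)
  next
    case False
    have "T (poly_op q v) = z *\<^sub>M poly_op q v"
      using Suc.prems(2) unfolding p poly_op_linear_factor by (simp add: poly_op_simps)
    moreover have "trace (poly_op q v) = 0" using Suc.prems(3) by (rule trace_poly_op)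
    ultimately have "poly_op q v = 0" using False by (auto simp: traceless_eigenvalues_def)
    then obtain ls where "set ls \<subseteq> traceless_eigenvalues" "length ls \<le> degree q" "apply_roots ls v = 0"
      using Suc(1)[OF deg q] Suc.prems(3) by blast
    then show ?thesis using Suc(2) deg by (intro exI[of _ ls]) auto
  qed
qed

text \<open>Applying \<open>T - m\<close> to a relation removes the eigenvector of \<open>m\<close> and multiplies the other
  coefficients by the nonzero numbers \<open>l - m\<close>.\<close>

lemma eigenvectors_independent:
  assumes "finite L" "\<And>l. l \<in> L \<Longrightarrow> X l \<noteq> 0 \<and> T (X l) = l *\<^sub>M X l"
    and "(\<Sum>l\<in>L. c l *\<^sub>M X l) = 0"
  shows "\<forall>l\<in>L. c l = 0"
  using assms
proof (induction L arbitrary: c rule: finite_induct)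
  case (insert m L)
  have eig: "T (X l) = l *\<^sub>M X l" "X l \<noteq> 0" if "l \<in> insert m L" for l
    using insert.prems(1) that by blast+
  have sum0: "c m *\<^sub>M X m + (\<Sum>l\<in>L. c l *\<^sub>M X l) = 0"
    using insert.prems(2) insert.hyps by simp
  have "0 = T (c m *\<^sub>M X m + (\<Sum>l\<in>L. c l *\<^sub>M X l)) - m *\<^sub>M (c m *\<^sub>M X m + (\<Sum>l\<in>L. c l *\<^sub>M X l))"
    by (simp only: sum0) (simp add: T_simps)
  also have "\<dots> = (\<Sum>l\<in>L. (c l * l) *\<^sub>M X l) - (\<Sum>l\<in>L. (m * c l) *\<^sub>M X l)"
    using eig by (simp add: T_simps T.sum mscale.scale_right_distrib mscale.scale_sum_right mult.commute)
  also have "\<dots> = (\<Sum>l\<in>L. (c l * (l - m)) *\<^sub>M X l)"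
    by (simp add: sum_subtractf[symmetric] mscale.scale_left_diff_distrib[symmetric] right_diff_distrib mult.commute)
  finally have "\<forall>l\<in>L. c l * (l - m) = 0"
    using insert.IH[of "\<lambda>l. c l * (l - m)"] insert.prems(1) by simp
  then have "\<forall>l\<in>L. c l = 0" using insert.hyps by auto
  moreover from this have "c m = 0" using sum0 eig(2)[of m] by simp
  ultimately show ?case by simp
qed simp

lemma finite_traceless_eigenvalues: "finite traceless_eigenvalues"
proof (rule ccontr)
  assume "infinite traceless_eigenvalues"
  then obtain L where L: "L \<subseteq> traceless_eigenvalues" "finite L" "card L = Suc DIM('n cmat)"
    using infinite_arbitrarily_large by blast
  then have "\<forall>l\<in>L. \<exists>Y. Y \<noteq> 0 \<and> T Y = l *\<^sub>M Y" by (auto simp: traceless_eigenvalues_def)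
  then obtain X where X: "\<And>l. l \<in> L \<Longrightarrow> X l \<noteq> 0 \<and> T (X l) = l *\<^sub>M X l" by metis
  have inj: "inj_on X L"
  proof (rule inj_onI)
    fix l m assume lm: "l \<in> L" "m \<in> L" "X l = X m"
    then have "(l - m) *\<^sub>M X m = 0" using X by (metis mscale.scale_left_diff_distrib right_minus_eq)
    then show "l = m" using X[OF lm(2)] by simp
  qed
  have "independent (X ` L)"
  proof
    assume "dependent (X ` L)"
    then obtain u where u: "\<exists>x\<in>X ` L. u x \<noteq> 0" "(\<Sum>x\<in>X ` L. u x *\<^sub>R x) = 0"
      using L(2) by (auto simp: dependent_finite)
    have "(\<Sum>l\<in>L. complex_of_real (u (X l)) *\<^sub>M X l) = 0"
      using u(2) unfolding sum.reindex[OF inj] o_def scaleR_eq_mscale .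
    then have "\<forall>l\<in>L. complex_of_real (u (X l)) = 0"
      by (rule eigenvectors_independent[OF L(2) X, rotated])
    then show False using u(1) by auto
  qed
  then have "card (X ` L) \<le> DIM('n cmat)" using independent_bound by blast
  then show False using L(3) by (simp add: card_image[OF inj])
qed

end

section \<open>Lower bound for the Blaschke product\<close>

text \<open>In the variable \<open>z = y / t\<close> this compares a factor of the Blaschke product of the disc of radius
  \<open>1 + \<delta>\<close> at \<open>z = 1\<close> with \<open>1\<close>: in modulus the denominator exceeds the numerator by at most
  \<open>1 - t\<^sup>2 \<le> 2 \<delta> t\<close>, which is at most the fraction \<open>1 / M\<close> of the numerator \<open>t \<bar>1 - l\<bar>\<close>.\<close>

lemma blaschke_factor_lower_bound:
  fixes l :: complex and \<delta> :: real
  assumes "0 < \<delta>" "0 < M" "2 * \<delta> * M \<le> cmod (1 - l)"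
  defines "t \<equiv> 1 / (1 + \<delta>)"
  shows "cmod (1 - cnj (t * l) * t) \<le> (1 + 1 / M) * cmod (t - t * l)"
proof -
  let ?x = "cmod (1 - l)"
  have t: "0 < t" "t < 1" using assms(1) by (auto simp: t_def)
  have t_eq: "1 - t = \<delta> * t" using assms(1) by (simp add: t_def field_simps)
  have "1 - t\<^sup>2 = (1 - t) * (1 + t)" by (simp add: power2_eq_square algebra_simps)
  then have t2_eq: "1 - t\<^sup>2 = \<delta> * t * (1 + t)" by (simp only: t_eq)
  note t2_eq
  also have "\<delta> * t * (1 + t) \<le> \<delta> * t * 2" using assms(1) t by (intro mult_left_mono) auto
  finally have "1 - t\<^sup>2 \<le> 2 * \<delta> * t" by simp
  also have "\<dots> \<le> ?x / M * t"
    using assms(2,3) t by (intro mult_right_mono) (auto simp: field_simps)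
  finally have gap: "1 - t\<^sup>2 \<le> t * ?x / M" by (simp add: mult.commute)
  have "cmod (1 - cnj (t * l) * t) = cmod (1 - t\<^sup>2 * l)"
    by (subst complex_mod_cnj[symmetric]) (simp add: power2_eq_square mult_ac)
  also have "\<dots> = cmod (complex_of_real (1 - t\<^sup>2) + complex_of_real (t\<^sup>2) * (1 - l))"
    by (simp add: algebra_simps)
  also have "\<dots> \<le> cmod (complex_of_real (1 - t\<^sup>2)) + cmod (complex_of_real (t\<^sup>2) * (1 - l))"
    by (rule norm_triangle_ineq)
  also have "\<dots> = (1 - t\<^sup>2) + t\<^sup>2 * ?x"
    using t by (simp only: norm_mult norm_of_real) (simp add: power_le_one)
  also have "\<dots> \<le> t * ?x / M + t * ?x"
    using gap t by (intro add_mono mult_right_mono) (auto simp: power2_eq_square mult_left_le)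
  also have "\<dots> = (1 + 1 / M) * (t * ?x)" by (simp add: algebra_simps)
  also have "t * ?x = cmod (complex_of_real t * (1 - l))"
    using t by (simp add: norm_mult)
  also have "complex_of_real t * (1 - l) = t - t * l" by (simp add: algebra_simps)
  finally show ?thesis .
qed

text \<open>At most \<open>M\<close> factors, each at least \<open>1 / (1 + 1 / M)\<close> in modulus, and \<open>(1 + 1 / M)^M \<le> e\<close>.\<close>

lemma blaschke_lower_bound:
  fixes ls :: "complex list" and \<delta> :: real
  assumes "0 < \<delta>" "0 < M" "length ls \<le> M"
    and ls: "\<And>l. l \<in> set ls \<Longrightarrow> cmod l \<le> 1 \<and> 2 * \<delta> * real M \<le> cmod (1 - l)"
  defines "t \<equiv> 1 / (1 + \<delta>)"
  shows "1 \<le> exp 1 * cmod (eval_fps (blaschke (map ((*) (complex_of_real t)) ls)) t)"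
proof -
  let ?t = "complex_of_real t" and ?c = "1 + 1 / real M"
  let ?B = "eval_fps (blaschke (map ((*) ?t) ls)) ?t"
  have t: "0 < t" "t < 1" using assms(1) by (auto simp: t_def)
  have small: "cmod (?t * l) < 1" if "l \<in> set ls" for l
  proof -
    have "cmod (?t * l) \<le> t * 1" using ls[OF that] t by (simp add: norm_mult)
    then show ?thesis using t by simp
  qed
  define den num where "den ls = (\<Prod>a\<leftarrow>map ((*) ?t) ls. 1 - cnj a * ?t)"
    and "num ls = (\<Prod>a\<leftarrow>map ((*) ?t) ls. ?t - a)" for ls
  have "?B * den ls = num ls"
    unfolding den_def num_def
    by (rule eval_blaschke[OF _ t]) (use small in \<open>auto intro: less_imp_le\<close>)
  have le: "cmod (den ls') \<le> ?c ^ length ls' * cmod (num ls')" if "set ls' \<subseteq> set ls" for ls'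
    using that
  proof (induction ls')
    case (Cons l ls')
    have "cmod (1 - cnj (?t * l) * ?t) \<le> ?c * cmod (?t - ?t * l)"
      unfolding t_def using assms(1,2) Cons.prems ls by (intro blaschke_factor_lower_bound) auto
    then have "cmod (1 - cnj (?t * l) * ?t) * cmod (den ls') \<le> (?c * cmod (?t - ?t * l)) * (?c ^ length ls' * cmod (num ls'))"
      using Cons by (intro mult_mono) auto
    then show ?case by (simp add: den_def num_def norm_mult mult_ac)
  qed (simp add: den_def num_def)
  have "den ls' \<noteq> 0" if "set ls' \<subseteq> set ls" for ls'
    using that
  proof (induction ls')
    case (Cons l ls')
    have "cmod (cnj (?t * l) * ?t) = cmod (?t * l) * t"
      using t by (simp add: norm_mult)
    also have "\<dots> \<le> cmod (?t * l) * 1" using t by (intro mult_left_mono) auto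
    also have "\<dots> < 1" using small[of l] Cons.prems by simp
    finally have "cmod (cnj (?t * l) * ?t) < 1" .
    then have "1 - cnj (?t * l) * ?t \<noteq> 0" by auto
    then show ?case using Cons by (simp add: den_def)
  qed (simp add: den_def)
  then have pos: "cmod (den ls) > 0" by simp
  have "cmod (den ls) \<le> ?c ^ length ls * cmod (?B * den ls)"
    using le[of ls] \<open>?B * den ls = num ls\<close> by simp
  then have "1 * cmod (den ls) \<le> (?c ^ length ls * cmod ?B) * cmod (den ls)"
    by (simp add: norm_mult mult_ac)
  then have "1 \<le> ?c ^ length ls * cmod ?B"
    using pos by (rule mult_right_le_imp_le)
  also have "\<dots> \<le> exp 1 * cmod ?B"
  proof (rule mult_right_mono)
    have "?c ^ length ls \<le> ?c ^ M" using assms(3) by (intro power_increasing) auto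
    also have "\<dots> \<le> exp 1" using exp_ge_one_plus_x_over_n_power_n[of M 1] assms(2) by simp
    finally show "?c ^ length ls \<le> exp 1" .
  qed simp
  finally show ?thesis .
qed

section \<open>The inverse of \<open>id - T\<close> on traceless matrices\<close>

locale uniquely_stationary_map = positive_tp_map T for T :: "'n::finite cmat \<Rightarrow> 'n cmat" +
  assumes unique: "\<exists>!\<rho>. stationary_state T \<rho>"
begin

text \<open>An eigenvector \<open>X\<close> for \<open>l \<noteq> 1\<close> is traceless, as \<open>tr X = tr (T X) = l tr X\<close>.\<close>

lemma traceless_eigenvalues_eq: "traceless_eigenvalues = op_spectrum T - {1}"
proof -
  have "trace X = 0" if "T X = l *\<^sub>M X" "l \<noteq> 1" for l X
  proof -
    have "trace X = l * trace X" using trace_T[of X] that(1) by (simp add: trace_mscale)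
    then show ?thesis using that(2) by simp
  qed
  moreover have "1 \<notin> traceless_eigenvalues"
    using traceless_fixed_eq_0[OF unique] by (auto simp: traceless_eigenvalues_def)
  ultimately show ?thesis
    unfolding op_spectrum_eq_eigenvalues[OF lin] by (auto simp: traceless_eigenvalues_def)
qed

lemma T_inf_eq_0: "trace X = 0 \<Longrightarrow> T_inf T X = 0"
  by (simp add: T_inf_def)

lemma trace_T_inf: "trace (T_inf T X) = trace X"
  using theI'[OF unique] by (simp add: T_inf_def trace_mscale stationary_state_def)

lemma Z_map_spec:
  assumes "trace \<sigma> = 0"
  shows "trace (Z_map T \<sigma>) = 0" "Z_map T \<sigma> - T (Z_map T \<sigma>) = \<sigma>"
    and Z_map_eqI: "\<And>w. trace w = 0 \<Longrightarrow> w - T w = \<sigma> \<Longrightarrow> Z_map T \<sigma> = w"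
proof -
  define g where "g = (\<lambda>X. X - T X + T_inf T X)"
  have tr: "trace (g X) = trace X" for X
    by (simp add: g_def trace_add trace_sub trace_T_inf)
  have "linear g"
    unfolding g_def T_inf_def
    by (intro linearI) (simp_all add: scaleR_eq_mscale T_simps trace_add trace_mscale
        mscale.scale_left_distrib mscale.scale_right_distrib mscale.scale_right_diff_distrib)
  moreover have "X = 0" if "g X = 0" for X
  proof -
    have "trace X = 0" using tr[of X] that by (simp add: trace_def[of 0])
    then show ?thesis
      using that traceless_fixed_eq_0[OF unique, of X] by (simp add: g_def T_inf_eq_0)
  qed
  ultimately have inj: "inj g" by (simp add: linear_injective_0)
  then have "surj g" using \<open>linear g\<close> linear_injective_imp_surjective by blast
  then have gZ: "g (Z_map T \<sigma>) = \<sigma>" by (simp add: Z_map_def g_def[symmetric] surj_f_inv_f)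
  then show tr0: "trace (Z_map T \<sigma>) = 0" using tr[of "Z_map T \<sigma>"] assms by simp
  show "Z_map T \<sigma> - T (Z_map T \<sigma>) = \<sigma>" using gZ tr0 by (simp add: g_def T_inf_eq_0)
  show "Z_map T \<sigma> = w" if "trace w = 0" "w - T w = \<sigma>" for w
  proof -
    have "g w = \<sigma>" using that by (simp add: g_def T_inf_eq_0)
    then show ?thesis using inj gZ by (auto dest: injD)
  qed
qed

lemma hermitian_Z_map:
  assumes "trace \<sigma> = 0" "dagger \<sigma> = \<sigma>"
  shows "dagger (Z_map T \<sigma>) = Z_map T \<sigma>"
proof -
  have "dagger (Z_map T \<sigma>) - T (dagger (Z_map T \<sigma>)) = dagger (Z_map T \<sigma> - T (Z_map T \<sigma>))"
    by (simp add: T_dagger dagger_simps)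
  also have "\<dots> = \<sigma>" by (simp add: Z_map_spec(2)[OF assms(1)] assms(2))
  finally have eq: "dagger (Z_map T \<sigma>) - T (dagger (Z_map T \<sigma>)) = \<sigma>" .
  have "trace (dagger (Z_map T \<sigma>)) = 0" by (simp add: trace_dagger Z_map_spec(1)[OF assms(1)])
  from Z_map_eqI[OF assms(1) this eq] show ?thesis by (rule sym)
qed

text \<open>The radius \<open>1 + \<delta> = 1 / t\<close> balances \<open>t / (1 - t\<^sup>2) \<le> 1 / \<delta>\<close> against \<open>1 / \<bar>B(t)\<bar>\<close>: with
  \<open>\<delta> = d / (2 M)\<close>, where \<open>M = 2 n\<^sup>2\<close> bounds the number of zeros, the latter is at most \<open>e\<close>.\<close>

lemma trace_norm_Z_map_le:
  assumes d: "0 < d" "\<And>l. l \<in> traceless_eigenvalues \<Longrightarrow> d \<le> cmod (1 - l)"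
    and \<sigma>: "trace \<sigma> = 0" "dagger \<sigma> = \<sigma>"
  shows "trace_norm (Z_map T \<sigma>) \<le> 4 * exp 1 * (real CARD('n))\<^sup>2 / d * trace_norm \<sigma>"
proof -
  define M where "M = DIM('n cmat)"
  define \<delta> where "\<delta> = d / (2 * real M)"
  define t where "t = 1 / (1 + \<delta>)"
  have M: "real M = 2 * (real CARD('n))\<^sup>2" "0 < M" by (simp_all add: M_def power2_eq_square)
  have \<delta>: "0 < \<delta>" "2 * \<delta> * real M = d" using d(1) M(2) by (auto simp: \<delta>_def)
  have t: "0 < t" "t < 1" using \<delta> by (auto simp: t_def)
  let ?w = "Z_map T \<sigma>"
  have w: "trace ?w = 0" "dagger ?w = ?w" "?w - T ?w = \<sigma>"
    by (rule Z_map_spec(1,2)[OF \<sigma>(1)] hermitian_Z_map[OF \<sigma>])+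
  obtain p where p: "p \<noteq> 0" "degree p \<le> M" "poly_op p ?w = 0"
    unfolding M_def using annihilating_poly_exists by blast
  obtain ls where ls: "set ls \<subseteq> traceless_eigenvalues" "length ls \<le> degree p" "apply_roots ls ?w = 0"
    using annihilating_roots[OF p(1,3) w(1)] by blast
  have le1: "cmod l \<le> 1" if "l \<in> set ls" for l
    using that ls(1) eigenvalue_cmod_le_1 by (auto simp: traceless_eigenvalues_def)
  define b where "b = cmod (eval_fps (blaschke (map ((*) (complex_of_real t)) ls)) t)"
  have b: "1 \<le> exp 1 * b"
    unfolding b_def t_def
  proof (rule blaschke_lower_bound[OF \<delta>(1) M(2)])
    show "length ls \<le> M" using ls(2) p(2) by simp
    show "cmod l \<le> 1 \<and> 2 * \<delta> * real M \<le> cmod (1 - l)" if "l \<in> set ls" for l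
      using that le1 ls(1) d(2) \<delta>(2) by auto
  qed
  have bound: "b / t * trace_norm ?w \<le> trace_norm \<sigma> / (1 - t\<^sup>2)"
    using resolvent_trace_norm_le[OF t le1 ls(3) w(2)] by (simp add: w(3) b_def)
  have tn: "0 \<le> trace_norm X" if "dagger X = X" for X :: "'n cmat"
    using hermitian_entry_le_trace_norm[OF that] order_trans[OF norm_ge_zero] by blast
  have t_eq: "1 - t = \<delta> * t" using \<delta>(1) by (simp add: t_def field_simps)
  have "1 - t\<^sup>2 = (1 - t) * (1 + t)" by (simp add: power2_eq_square algebra_simps)
  then have t2_eq: "1 - t\<^sup>2 = \<delta> * t * (1 + t)" by (simp only: t_eq)
  then have "\<delta> * t \<le> 1 - t\<^sup>2" using \<delta>(1) t by (simp only: t2_eq) (simp add: algebra_simps)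
  then have t2: "1 / (1 - t\<^sup>2) \<le> 1 / (\<delta> * t)"
    using \<delta>(1) t by (intro divide_left_mono) (auto simp: power_less_one_iff)
  have "trace_norm ?w \<le> (exp 1 * b) * trace_norm ?w"
    using b tn[OF w(2)] by (simp add: mult_right_mono mult_le_cancel_right1)
  also have "\<dots> = exp 1 * t * (b / t * trace_norm ?w)" using t by simp
  also have "\<dots> \<le> exp 1 * t * (trace_norm \<sigma> * (1 / (1 - t\<^sup>2)))"
    using bound t by (intro mult_left_mono) auto
  also have "\<dots> \<le> exp 1 * t * (trace_norm \<sigma> * (1 / (\<delta> * t)))"
    using t2 t tn[OF \<sigma>(2)] by (intro mult_left_mono) auto
  also have "\<dots> = exp 1 / \<delta> * trace_norm \<sigma>" using t by simp
  also have "exp 1 / \<delta> = 4 * exp 1 * (real CARD('n))\<^sup>2 / d" by (simp add: \<delta>_def M(1))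
  finally show ?thesis .
qed

lemma herm_part_scale_real: "herm_part (complex_of_real r *\<^sub>M X) = complex_of_real r *\<^sub>M herm_part X"
  by (simp add: herm_part_def dagger_simps mscale.scale_right_distrib mult.commute)

text \<open>An eigenvector \<open>X\<close> need not be Hermitian. Among the Hermitian parts \<open>H\<^sub>c\<close> of the rotated vectors
  \<open>c X\<close>, \<open>\<bar>c\<bar> = 1\<close>, the inverse acts by \<open>Z (\<bar>1 - l\<bar> H\<^sub>c\<^sub>') = H\<^sub>c\<close> with
  \<open>c' = c (1 - l) / \<bar>1 - l\<bar>\<close>; taking the supremum of the trace norm over \<open>c\<close> on both sides gives
  \<open>1 \<le> K \<bar>1 - l\<bar>\<close>.\<close>

lemma eigenvalue_lower_bound:
  assumes l: "l \<in> traceless_eigenvalues"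
    and K: "\<And>\<sigma>. trace \<sigma> = 0 \<Longrightarrow> dagger \<sigma> = \<sigma> \<Longrightarrow> trace_norm (Z_map T \<sigma>) \<le> K * trace_norm \<sigma>"
  shows "1 / cmod (1 - l) \<le> K"
proof -
  obtain X where X: "X \<noteq> 0" "trace X = 0" "T X = l *\<^sub>M X"
    using l by (auto simp: traceless_eigenvalues_def)
  have l1: "l \<noteq> 1" using l traceless_eigenvalues_eq by auto
  define \<Omega> where "\<Omega> = sphere (0::complex) 1"
  define N where "N c = trace_norm (herm_part (c *\<^sub>M X))" for c
  have N0: "0 \<le> N c" for c
    unfolding N_def using hermitian_entry_le_trace_norm[OF dagger_herm_part] order_trans[OF norm_ge_zero] by blast
  have tr: "trace (herm_part (c *\<^sub>M X)) = 0" for c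
    by (rule trace_herm_part) (simp add: trace_mscale X(2))
  have step: "\<exists>c'\<in>\<Omega>. N c \<le> K * cmod (1 - l) * N c'" if "c \<in> \<Omega>" for c
  proof -
    define c' where "c' = c * (1 - l) / cmod (1 - l)"
    have c': "c * (1 - l) = complex_of_real (cmod (1 - l)) * c'" using l1 by (simp add: c'_def)
    have "herm_part (c *\<^sub>M X) - T (herm_part (c *\<^sub>M X)) = herm_part ((c * (1 - l)) *\<^sub>M X)"
      by (simp add: herm_part_def T_simps T_dagger X(3) dagger_simps)
        (simp add: mscale_def vec_eq_iff dagger_def algebra_simps)
    also have "\<dots> = complex_of_real (cmod (1 - l)) *\<^sub>M herm_part (c' *\<^sub>M X)"
      by (simp only: c' herm_part_scale_real mscale.scale_scale[symmetric])
    finally have eq: "herm_part (c *\<^sub>M X) - T (herm_part (c *\<^sub>M X)) = complex_of_real (cmod (1 - l)) *\<^sub>M herm_part (c' *\<^sub>M X)" .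
    let ?\<sigma> = "complex_of_real (cmod (1 - l)) *\<^sub>M herm_part (c' *\<^sub>M X)"
    have \<sigma>: "trace ?\<sigma> = 0" "dagger ?\<sigma> = ?\<sigma>" by (simp_all add: trace_mscale tr dagger_simps)
    have "N c \<le> K * trace_norm ?\<sigma>"
      using K[OF \<sigma>] Z_map_eqI[OF \<sigma>(1) tr eq] by (simp add: N_def)
    also have "\<dots> = K * cmod (1 - l) * N c'" by (simp add: trace_norm_scale N_def)
    finally show ?thesis using that l1
      by (intro bexI[of _ c']) (auto simp: \<Omega>_def c'_def norm_mult norm_divide)
  qed
  have "N c \<le> N 1 + N \<i>" if "c \<in> \<Omega>" for c
  proof -
    have "herm_part (c *\<^sub>M X) = complex_of_real (Re c) *\<^sub>M herm_part X + complex_of_real (Im c) *\<^sub>M herm_part (\<i> *\<^sub>M X)"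
    proof -
      have "c *\<^sub>M X = complex_of_real (Re c) *\<^sub>M X + complex_of_real (Im c) *\<^sub>M \<i> *\<^sub>M X"
        by (subst complex_eq[of c]) (simp add: mscale.scale_left_distrib mult.commute)
      moreover have "herm_part (A + B) = herm_part A + herm_part B" for A B :: "'n cmat"
        by (simp add: herm_part_def dagger_simps mscale.scale_right_distrib add_ac)
      ultimately show ?thesis by (simp only: herm_part_scale_real)
    qed
    then have "N c \<le> \<bar>Re c\<bar> * N 1 + \<bar>Im c\<bar> * N \<i>"
      unfolding N_def
      using trace_norm_add_le[of "complex_of_real (Re c) *\<^sub>M herm_part X" "complex_of_real (Im c) *\<^sub>M herm_part (\<i> *\<^sub>M X)"]
      by (simp add: dagger_simps trace_norm_scale)
    also have "\<dots> \<le> 1 * N 1 + 1 * N \<i>"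
      using that abs_Re_le_cmod[of c] abs_Im_le_cmod[of c] N0
      by (intro add_mono mult_right_mono) (auto simp: \<Omega>_def)
    finally show ?thesis by simp
  qed
  then have bdd: "bdd_above (N ` \<Omega>)" by (intro bdd_aboveI2)
  define m where "m = (SUP c\<in>\<Omega>. N c)"
  have Nm: "N c \<le> m" if "c \<in> \<Omega>" for c
    unfolding m_def using that bdd by (rule cSUP_upper)
  have "\<exists>c\<in>\<Omega>. N c > 0"
  proof -
    have "herm_part (1 *\<^sub>M X) \<noteq> 0 \<or> herm_part ((- \<i>) *\<^sub>M X) \<noteq> 0"
      using X(1) herm_part_decomp[of X] by (metis mscale.scale_one mscale.scale_zero_right add_0)
    then show ?thesis
      unfolding N_def \<Omega>_def by (metis dagger_herm_part trace_norm_pos mem_sphere_0 norm_one norm_minus_cancel norm_ii)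
  qed
  then obtain c0 where c0: "c0 \<in> \<Omega>" "N c0 > 0" by blast
  then have mpos: "m > 0" using Nm[OF c0(1)] by linarith
  have Kpos: "K * cmod (1 - l) > 0"
    using step[OF c0(1)] c0(2) N0 by (smt (verit) mult_nonpos_nonneg)
  have "m \<le> K * cmod (1 - l) * m"
    unfolding m_def
  proof (rule cSUP_least)
    show "\<Omega> \<noteq> {}" using c0(1) by blast
    fix c assume "c \<in> \<Omega>"
    then obtain c' where c': "c' \<in> \<Omega>" "N c \<le> K * cmod (1 - l) * N c'" using step by blast
    note c'(2)
    also have "K * cmod (1 - l) * N c' \<le> K * cmod (1 - l) * m"
      using Kpos Nm[OF c'(1)] by (intro mult_left_mono) auto
    finally show "N c \<le> K * cmod (1 - l) * (SUP c\<in>\<Omega>. N c)" by (simp add: m_def)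
  qed
  then have "1 \<le> K * cmod (1 - l)" using mpos by simp
  then show ?thesis using l1 by (simp add: divide_le_eq)
qed

text \<open>With no eigenvalues available, the annihilating product for \<open>\<sigma>\<close> is empty.\<close>

lemma traceless_eigenvalues_nonempty:
  fixes \<sigma> :: "'n cmat"
  assumes "trace \<sigma> = 0" "\<sigma> \<noteq> 0"
  shows "traceless_eigenvalues \<noteq> {}"
proof
  assume empty: "traceless_eigenvalues = {}"
  obtain p where "p \<noteq> 0" "poly_op p \<sigma> = 0" using annihilating_poly_exists by blast
  then obtain ls where "set ls \<subseteq> traceless_eigenvalues" "apply_roots ls \<sigma> = 0"
    using annihilating_roots assms(1) by blast
  then show False using empty assms(2) by (auto simp: apply_roots_def)
qed

end

section \<open>The two-sided bound\<close>

lemma traceless_hermitian_exists: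
  assumes "CARD('n::finite) \<ge> 2"
  obtains \<sigma> :: "'n::finite cmat" where "dagger \<sigma> = \<sigma>" "trace \<sigma> = 0" "\<sigma> \<noteq> 0"
proof -
  obtain a b :: 'n where ab: "a \<noteq> b"
    using assms by (metis (full_types) UNIV_I card_2_iff' card_le_Suc0_iff_eq finite numeral_2_eq_2 not_less_eq_eq)
  define f :: "'n \<Rightarrow> complex" where "f i = (if i = a then 1 else 0) - (if i = b then 1 else 0)" for i
  define \<sigma> :: "'n cmat" where "\<sigma> = (\<chi> i j. if i = j then f i else 0)"
  have "dagger \<sigma> = \<sigma>" by (auto simp: dagger_def \<sigma>_def vec_eq_iff f_def)
  moreover have "trace \<sigma> = 0" by (simp add: trace_def \<sigma>_def f_def sum_subtractf)
  moreover have "\<sigma> $ a $ a = 1" using ab by (simp add: \<sigma>_def f_def)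
  then have "\<sigma> \<noteq> 0" by auto
  ultimately show thesis using that by blast
qed

theorem theoremV1:
  fixes T :: "complex ^ 'n::finite ^ 'n \<Rightarrow> complex ^ 'n ^ 'n"
    and \<Lambda> :: "complex set"
  assumes "CARD('n) \<ge> 2"
    and "Vector_Spaces.linear mscale mscale T"
    and "trace_preserving T"
    and "positive_map T"
    and "\<exists>!\<rho>. stationary_state T \<rho>"
    and "\<Lambda> = op_spectrum T - {1}"
  shows "1 / Min ((\<lambda>l. cmod (1 - l)) ` \<Lambda>) \<le> kappa_qu T
       \<and> kappa_qu T \<le> 2 * sqrt (16 * exp 1 - 4) * (real CARD('n))\<^sup>2 / Min ((\<lambda>l. cmod (1 - l)) ` \<Lambda>)"
proof -
  interpret uniquely_stationary_map T
    by (intro uniquely_stationary_map.intro positive_tp_map.intro uniquely_stationary_map_axioms.intro assms)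
  have \<Lambda>: "\<Lambda> = traceless_eigenvalues" by (simp add: assms(6) traceless_eigenvalues_eq)
  obtain \<sigma>0 :: "'n cmat" where \<sigma>0: "dagger \<sigma>0 = \<sigma>0" "trace \<sigma>0 = 0" "\<sigma>0 \<noteq> 0"
    using traceless_hermitian_exists[OF assms(1)] .
  define D where "D = (\<lambda>l. cmod (1 - l)) ` \<Lambda>"
  define d where "d = Min D"
  have D: "finite D" "D \<noteq> {}"
    unfolding D_def \<Lambda> using finite_traceless_eigenvalues traceless_eigenvalues_nonempty[OF \<sigma>0(2,3)] by auto
  have dD: "d \<in> D" unfolding d_def using D by (rule Min_in)
  then have dpos: "0 < d" unfolding D_def assms(6) by auto
  have dle: "d \<le> cmod (1 - l)" if "l \<in> traceless_eigenvalues" for l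
    unfolding d_def using that D by (intro Min_le) (auto simp: D_def \<Lambda>)
  define U where "U = 4 * exp 1 * (real CARD('n))\<^sup>2 / d"
  define S where "S = {\<sigma> :: 'n cmat. \<sigma> = dagger \<sigma> \<and> trace \<sigma> = 0 \<and> \<sigma> \<noteq> 0}"
  have ratio: "trace_norm (Z_map T \<sigma>) / trace_norm \<sigma> \<le> U" and pos: "0 < trace_norm \<sigma>" if "\<sigma> \<in> S" for \<sigma>
  proof -
    have \<sigma>: "trace \<sigma> = 0" "dagger \<sigma> = \<sigma>" "\<sigma> \<noteq> 0" using that by (auto simp: S_def)
    show "0 < trace_norm \<sigma>" using trace_norm_pos[OF \<sigma>(2,3)] .
    then show "trace_norm (Z_map T \<sigma>) / trace_norm \<sigma> \<le> U"
      using trace_norm_Z_map_le[OF dpos dle \<sigma>(1,2)] by (simp add: U_def divide_le_eq)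
  qed
  have kappa: "kappa_qu T = (SUP \<sigma>\<in>S. trace_norm (Z_map T \<sigma>) / trace_norm \<sigma>)"
    by (simp add: kappa_qu_def S_def)
  have "kappa_qu T \<le> U"
    unfolding kappa using \<sigma>0 ratio by (intro cSUP_least) (auto simp: S_def)
  \<comment> \<open>\<open>2 e \<le> sqrt (16 e - 4)\<close> amounts to \<open>e\<^sup>2 - 4 e + 1 \<le> 0\<close>, which holds for \<open>1 \<le> e \<le> 3\<close>.\<close>
  also have "U \<le> 2 * sqrt (16 * exp 1 - 4) * (real CARD('n))\<^sup>2 / d"
  proof -
    have e: "1 \<le> exp (1::real)" "exp (1::real) \<le> 3" using exp_le by auto
    then have "exp (1::real) * exp 1 \<le> 3 * exp 1" by (intro mult_right_mono) auto
    moreover have "(2 * exp 1)\<^sup>2 = 4 * (exp (1::real) * exp 1)" by (simp add: power2_eq_square)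
    ultimately have "(2 * exp 1)\<^sup>2 \<le> 16 * exp (1::real) - 4" using e(1) by linarith
    then have "2 * exp 1 \<le> sqrt (16 * exp 1 - 4)" by (rule real_le_rsqrt)
    then have "4 * exp 1 * (real CARD('n))\<^sup>2 \<le> 2 * sqrt (16 * exp 1 - 4) * (real CARD('n))\<^sup>2"
      by (intro mult_right_mono) auto
    then show ?thesis unfolding U_def using dpos by (intro divide_right_mono) auto
  qed
  finally have upper: "kappa_qu T \<le> 2 * sqrt (16 * exp 1 - 4) * (real CARD('n))\<^sup>2 / d" .
  have bdd: "bdd_above ((\<lambda>\<sigma>. trace_norm (Z_map T \<sigma>) / trace_norm \<sigma>) ` S)"
    using ratio by (intro bdd_aboveI2)
  have K: "trace_norm (Z_map T \<sigma>) \<le> kappa_qu T * trace_norm \<sigma>" if "trace \<sigma> = 0" "dagger \<sigma> = \<sigma>" for \<sigma>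
  proof (cases "\<sigma> = 0")
    case True
    have "Z_map T 0 = 0" by (rule Z_map_eqI) (simp_all add: T_simps trace_def)
    moreover have "trace_norm (0 :: 'n cmat) = 0"
      using trace_norm_scale[of "0 :: 'n cmat" 0] by (simp add: dagger_simps)
    ultimately show ?thesis using True by simp
  next
    case False
    then have S: "\<sigma> \<in> S" using that by (simp add: S_def)
    have "trace_norm (Z_map T \<sigma>) / trace_norm \<sigma> \<le> kappa_qu T"
      unfolding kappa using S bdd by (rule cSUP_upper)
    then show ?thesis using pos[OF S] by (simp add: divide_le_eq)
  qed
  obtain l where l: "l \<in> traceless_eigenvalues" "d = cmod (1 - l)"
    using dD by (auto simp: D_def \<Lambda>)
  have "1 / d \<le> kappa_qu T"
    unfolding l(2) using eigenvalue_lower_bound[OF l(1) K] .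
  then show ?thesis using upper by (simp add: d_def D_def)
qed

end
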